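(* Let $\phi_c(x)=x^2+c$ with $c\in\mathbb{Z}$, and let $p\geq3$ be a prime. Let $f_p(t)=\frac{1}{t}\phi_t^p(0)\in\mathbb{Z}[t]$, where $\phi_t(x)=x^2+t$ with $t$ an indeterminate. Suppose there is no $y\in\mathbb{Z}$ with $y^2=f_p(c)$ and no $y\in\mathbb{Z}$ with $-y^2=f_p(c)$ (i.e. $c$ does not give an integral point on either curve $y^2=f_p(t)$ or $-y^2=f_p(t)$). Then $G_{p-1}(\phi_c)=\operatorname{Aut}(T_{2,p-1})$ implies $G_{p}(\phi_c)=\operatorname{Aut}(T_{2,p})$.
   Context: $\phi^n$ denotes the $n$-th iterate. For $\phi\in\mathbb{Q}[x]$ quadratic, $K_n$ is the splitting field of $\phi^n(x)$ over $\mathbb{Q}$ and $G_n(\phi)=\operatorname{Gal}(K_n/\mathbb{Q})$. $T_{2,n}$ is the complete rooted binary tree with $n$ levels; $G_n(\phi)=\operatorname{Aut}(T_{2,n})$ means that $\phi^n(x)$ has $2^n$ distinct roots and the natural faithful action of $G_n(\phi)$ on the preimage tree of $0$ (vertices the roots of $\phi^j(x)$, $0\le j\le n$, root vertex $0$, edges $\alpha\to\phi(\alpha)$) is onto the full automorphism group of that tree (equivalently $[K_n:\mathbb{Q}]=2^{2^n-1}$). *)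

theory Defs
  imports "HOL-Algebra.Algebra" "HOL-Algebra.Algebraic_Closure_Type"
    "HOL-Computational_Algebra.Computational_Algebra"
begin

section \<open>Splitting fields and Galois groups over the rationals\<close>

text \<open>Number fields are realised as subfields of the complex numbers.\<close>

abbreviation complex_ring :: "complex ring"
  where "complex_ring \<equiv> ring_of_type_algebra"

definition complex_roots :: "rat poly \<Rightarrow> complex set"
  where "complex_roots f = {z. poly (map_poly of_rat f) z = 0}"

definition splitting_field :: "rat poly \<Rightarrow> complex set"
  where "splitting_field f = generate_field complex_ring (\<rat> \<union> complex_roots f)"

text \<open>For a subfield \<open>L\<close> of the complex numbers, the field automorphisms of \<open>L\<close> over the
  rationals, as a subgroup of \<^term>\<open>BijGroup L\<close>; the elements are undefined outside \<open>L\<close>.\<close>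

definition galois_group :: "complex set \<Rightarrow> (complex \<Rightarrow> complex) monoid"
  where "galois_group L = BijGroup L
    \<lparr>carrier := {\<sigma> \<in> Bij L.
       \<sigma> \<in> ring_hom (complex_ring\<lparr>carrier := L\<rparr>) (complex_ring\<lparr>carrier := L\<rparr>) \<and>
       (\<forall>q \<in> \<rat> \<inter> L. \<sigma> q = q)}\<rparr>"


section \<open>Iterates of quadratic polynomials\<close>

definition poly_iterate :: "'a::comm_ring_1 poly \<Rightarrow> nat \<Rightarrow> 'a poly"
  where "poly_iterate \<phi> n = (pcompose \<phi> ^^ n) [:0, 1:]"

definition quad :: "'a::comm_ring_1 \<Rightarrow> 'a poly"
  where "quad c = [:c, 0, 1:]"

text \<open>Here \<open>[:0, 1:] :: int poly\<close> is the indeterminate \<open>t\<close>. The division by \<open>t\<close> is exact,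
  see \<open>f_poly_exact\<close> below.\<close>

definition f_poly :: "nat \<Rightarrow> int poly"
  where "f_poly n = poly (poly_iterate (quad [:0, 1:]) n) 0 div [:0, 1:]"

lemma f_poly_exact: "[:0, 1:] * f_poly n = poly (poly_iterate (quad [:0, 1:]) n) 0"
proof -
  have "[:0, 1::int:] dvd poly (poly_iterate (quad [:0, 1:]) n) 0"
  proof (induction n)
    case 0
    show ?case by (simp add: poly_iterate_def)
  next
    case (Suc n)
    show ?case using Suc
      by (simp add: poly_iterate_def quad_def poly_pcompose dvd_add dvd_mult)
  qed
  then show ?thesis
    unfolding f_poly_def by (rule dvd_mult_div_cancel)
qed


section \<open>The preimage tree of 0 and the arboreal Galois action\<close>

text \<open>A vertex is a pair of a level \<open>j\<close> and a root of the \<open>j\<close>-th iterate; the level keeps the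
  vertices of different levels apart even if the iterates have common roots.\<close>

definition tree_verts :: "rat poly \<Rightarrow> nat \<Rightarrow> (nat \<times> complex) set"
  where "tree_verts \<phi> n = (SIGMA j:{0..n}. complex_roots (poly_iterate \<phi> j))"

definition tree_edges :: "rat poly \<Rightarrow> nat \<Rightarrow> ((nat \<times> complex) \<times> (nat \<times> complex)) set"
  where "tree_edges \<phi> n =
    {((Suc j, \<alpha>), (j, poly (map_poly of_rat \<phi>) \<alpha>)) | j \<alpha>. (Suc j, \<alpha>) \<in> tree_verts \<phi> n}"

definition tree_aut_group ::
    "rat poly \<Rightarrow> nat \<Rightarrow> (nat \<times> complex \<Rightarrow> nat \<times> complex) monoid"
  where "tree_aut_group \<phi> n = BijGroup (tree_verts \<phi> n)
    \<lparr>carrier := {\<pi> \<in> Bij (tree_verts \<phi> n).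
       \<pi> (0, 0) = (0, 0) \<and>
       (\<forall>u \<in> tree_verts \<phi> n. \<forall>v \<in> tree_verts \<phi> n.
          (\<pi> u, \<pi> v) \<in> tree_edges \<phi> n \<longleftrightarrow> (u, v) \<in> tree_edges \<phi> n)}\<rparr>"

definition arboreal_galois_group :: "rat poly \<Rightarrow> nat \<Rightarrow> (complex \<Rightarrow> complex) monoid"
  where "arboreal_galois_group \<phi> n = galois_group (splitting_field (poly_iterate \<phi> n))"

definition tree_action ::
    "rat poly \<Rightarrow> nat \<Rightarrow> (complex \<Rightarrow> complex) \<Rightarrow> (nat \<times> complex \<Rightarrow> nat \<times> complex)"
  where "tree_action \<phi> n \<sigma> = (\<lambda>(j, \<alpha>) \<in> tree_verts \<phi> n. (j, \<sigma> \<alpha>))"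

text \<open>The Galois group of the \<open>n\<close>-th iterate of a quadratic \<open>\<phi>\<close> is the full automorphism group
  of the complete binary tree with \<open>n\<close> levels. Membership in \<^const>\<open>iso\<close> says that the action on
  the preimage tree is faithful and onto all tree automorphisms; the first conjunct makes the
  preimage tree a complete binary one.\<close>

definition full_arboreal_image :: "rat poly \<Rightarrow> nat \<Rightarrow> bool"
  where "full_arboreal_image \<phi> n \<longleftrightarrow>
    card (complex_roots (poly_iterate \<phi> n)) = 2 ^ n \<and>
    tree_action \<phi> n \<in> iso (arboreal_galois_group \<phi> n) (tree_aut_group \<phi> n)"

end

theory Submission
  imports Defs
begin

text \<open>Write \<open>q(z) = z\<^sup>2 + c\<close>, let \<open>R k\<close> be the set of roots of \<open>q\<^sup>k\<close>, \<open>K k\<close> its splitting field and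
  \<open>a k = q\<^sup>k(0)\<close>. Since \<open>K (k+1)\<close> arises from \<open>K k\<close> by adjoining the square roots of \<open>\<gamma> - c\<close> for
  \<open>\<gamma> \<in> R k\<close>, the Galois action on \<open>n\<close> levels is full iff for every \<open>k < n\<close> these square roots are
  multiplicatively independent modulo \<open>K k\<close> (\<open>indep k\<close>). A dependency at level \<open>m\<close> can be
  averaged over Galois elements that flip a single vertex, until it says that \<open>a (m+1)\<close> is a
  square in \<open>K m\<close>. A rational number that becomes a square in \<open>K m\<close> is, by Kummer theory and
  the transitivity of the action on each level, a rational square up to sign and factors \<open>a k\<close>
  with \<open>k \<le> m\<close>. For \<open>m + 1 = p\<close> prime, the factor \<open>f\<^sub>p(c)\<close> of \<open>a p = c f\<^sub>p(c)\<close> is coprime to all of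
  \<open>a 1, \<dots>, a m\<close>, since \<open>a\<close> is a divisibility sequence; so \<open>f\<^sub>p(c)\<close> would be a square up to sign.\<close>

section \<open>Subfields and their homomorphisms\<close>

text \<open>As a predicate on sets stable under intersection, it makes
  \<open>is_subfield hull A\<close> the field generated by \<open>A\<close>. Since
  \<open>inverse 0 = 0\<close>, closure under inverses needs no exception at 0.\<close>

definition is_subfield :: "'a::field set \<Rightarrow> bool"
  where "is_subfield K \<longleftrightarrow> 0 \<in> K \<and> 1 \<in> K \<and>
    (\<forall>x\<in>K. - x \<in> K \<and> inverse x \<in> K) \<and> (\<forall>x\<in>K. \<forall>y\<in>K. x + y \<in> K \<and> x * y \<in> K)"

lemma is_subfieldI:
  assumes "0 \<in> K" "1 \<in> K" "\<And>x. x \<in> K \<Longrightarrow> - x \<in> K" "\<And>x. x \<in> K \<Longrightarrow> inverse x \<in> K"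
    "\<And>x y. x \<in> K \<Longrightarrow> y \<in> K \<Longrightarrow> x + y \<in> K" "\<And>x y. x \<in> K \<Longrightarrow> y \<in> K \<Longrightarrow> x * y \<in> K"
  shows "is_subfield K"
  using assms by (simp add: is_subfield_def)

lemma is_subfieldD:
  assumes "is_subfield K"
  shows "0 \<in> K" "1 \<in> K"
    "x \<in> K \<Longrightarrow> - x \<in> K" "x \<in> K \<Longrightarrow> inverse x \<in> K"
    "x \<in> K \<Longrightarrow> y \<in> K \<Longrightarrow> x + y \<in> K" "x \<in> K \<Longrightarrow> y \<in> K \<Longrightarrow> x * y \<in> K"
    "x \<in> K \<Longrightarrow> y \<in> K \<Longrightarrow> x - y \<in> K" "x \<in> K \<Longrightarrow> y \<in> K \<Longrightarrow> x / y \<in> K"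
    "x \<in> K \<Longrightarrow> x ^ n \<in> K"
proof -
  note * = assms[unfolded is_subfield_def]
  show "0 \<in> K" "1 \<in> K"
    "x \<in> K \<Longrightarrow> - x \<in> K" "x \<in> K \<Longrightarrow> inverse x \<in> K"
    "x \<in> K \<Longrightarrow> y \<in> K \<Longrightarrow> x + y \<in> K" "x \<in> K \<Longrightarrow> y \<in> K \<Longrightarrow> x * y \<in> K"
    using * by auto
  show "x \<in> K \<Longrightarrow> y \<in> K \<Longrightarrow> x - y \<in> K"
    using * by (metis diff_conv_add_uminus)
  show "x \<in> K \<Longrightarrow> y \<in> K \<Longrightarrow> x / y \<in> K"
    using * by (metis divide_inverse)
  show "x \<in> K \<Longrightarrow> x ^ n \<in> K"
    using * by (induction n) auto
qed

lemma is_subfield_of_nat: "is_subfield K \<Longrightarrow> of_nat n \<in> K"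
  by (induction n) (auto simp: is_subfieldD)

lemma is_subfield_of_int: "is_subfield K \<Longrightarrow> of_int n \<in> K"
  by (cases n rule: int_diff_cases) (auto simp: is_subfieldD is_subfield_of_nat)

lemma is_subfield_Rats: "is_subfield K \<Longrightarrow> (\<rat> :: 'a::field_char_0 set) \<subseteq> K"
proof
  fix x :: 'a assume "is_subfield K" "x \<in> \<rat>"
  then show "x \<in> K" by (elim Rats_cases') (simp add: is_subfieldD(8) is_subfield_of_int)
qed

lemma is_subfield_prod:
  "is_subfield K \<Longrightarrow> (\<And>i. i \<in> I \<Longrightarrow> f i \<in> K) \<Longrightarrow> prod f I \<in> K"
  by (induction I rule: infinite_finite_induct) (auto simp: is_subfieldD)

lemma is_subfield_hull: "is_subfield (is_subfield hull A)"
  by (rule hull_in) (auto simp: is_subfield_def Ball_def)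

section \<open>Quadratic extensions and Kummer theory for square roots\<close>

lemma hull_insert_sqrt:
  fixes s :: "'a::field"
  assumes K: "is_subfield K" and s2: "s\<^sup>2 \<in> K"
  shows "is_subfield hull (insert s K) = {a + b * s | a b. a \<in> K \<and> b \<in> K}" (is "_ = ?S")
proof
  note KD = is_subfieldD[OF K]
  show "?S \<subseteq> is_subfield hull (insert s K)"
    by (auto intro!: is_subfieldD[OF is_subfield_hull] intro: hull_inc)
  have "is_subfield ?S"
  \<comment> \<open>For \<open>s \<notin> K\<close> the conjugate \<open>a - b * s\<close> of a
    nonzero element is nonzero, so inverses can be found by rationalising; for
    \<open>s \<in> K\<close> the set is \<open>K\<close> itself.\<close>
  proof (cases "s \<in> K")
    case True
    have "?S = K"
    proof
      show "?S \<subseteq> K" using True KD by auto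
      show "K \<subseteq> ?S"
      proof
        fix x assume "x \<in> K"
        then show "x \<in> ?S" using KD(1) by (intro CollectI exI[of _ x] exI[of _ 0]) auto
      qed
    qed
    then show ?thesis using K by simp
  next
    case False
    show ?thesis
      unfolding is_subfield_def
    proof (intro conjI ballI)
      show "0 \<in> ?S" using KD by (intro CollectI exI[of _ 0]) auto
      show "1 \<in> ?S" using KD by (intro CollectI exI[of _ 1] exI[of _ 0]) auto
    next
      fix x assume "x \<in> ?S"
      then obtain a b where x: "x = a + b * s" "a \<in> K" "b \<in> K" by blast
      have "- x = - a + (- b) * s" unfolding x(1) by simp
      moreover have "- a \<in> K" "- b \<in> K" using x by (simp_all add: KD)
      ultimately show "- x \<in> ?S" by blast
      show "inverse x \<in> ?S"
      proof (cases "x = 0")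
        case True
        then show ?thesis using KD by (intro CollectI exI[of _ 0]) auto
      next
        case x0: False
        \<comment> \<open>The norm of \<open>x\<close>: it lies in \<open>K\<close>, and the inverse
          of \<open>x\<close> is its conjugate divided by \<open>N\<close>.\<close>
        define N where "N = a\<^sup>2 - b\<^sup>2 * s\<^sup>2"
        have N: "N = x * (a - b * s)"
          unfolding N_def x(1) by (simp add: algebra_simps power2_eq_square)
        have "a - b * s \<noteq> 0"
        proof
          assume eq: "a - b * s = 0"
          show False
          proof (cases "b = 0")
            case True
            then show False using eq x(1) x0 by simp
          next
            case False
            then have "s = a / b" using eq by (simp add: field_simps)
            then show False using KD(8) x \<open>s \<notin> K\<close> by simp
          qed
        qed
        then have "N \<noteq> 0" and inv: "inverse x = (a - b * s) / N"
          using N x0 by (auto simp: field_simps)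
        have "N \<in> K" unfolding N_def using x s2 by (simp add: KD)
        then have "a / N \<in> K" "- b / N \<in> K" using x by (simp_all add: KD)
        moreover have "inverse x = a / N + (- b / N) * s"
          unfolding inv by (simp add: diff_divide_distrib)
        ultimately show ?thesis by blast
      qed
    next
      fix x y assume "x \<in> ?S" "y \<in> ?S"
      then obtain a b a' b' where x: "x = a + b * s" "a \<in> K" "b \<in> K"
        and y: "y = a' + b' * s" "a' \<in> K" "b' \<in> K" by blast
      have "x + y = (a + a') + (b + b') * s"
        unfolding x(1) y(1) by (simp add: algebra_simps)
      moreover have "a + a' \<in> K" "b + b' \<in> K" using x y by (simp_all add: KD)
      ultimately show "x + y \<in> ?S" by blast
      have "x * y = (a * a' + b * b' * s\<^sup>2) + (a * b' + b * a') * s"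
        unfolding x(1) y(1) by (simp add: algebra_simps power2_eq_square)
      moreover have "a * a' + b * b' * s\<^sup>2 \<in> K" "a * b' + b * a' \<in> K"
        using x y s2 by (simp_all add: KD)
      ultimately show "x * y \<in> ?S" by blast
    qed
  qed
  moreover have "insert s K \<subseteq> ?S"
  proof
    fix x assume "x \<in> insert s K"
    then consider "x = s" | "x \<in> K" by blast
    then show "x \<in> ?S"
    proof cases
      case 1
      then show ?thesis using KD by (intro CollectI exI[of _ 0] exI[of _ 1]) auto
    next
      case 2
      then show ?thesis using KD by (intro CollectI exI[of _ x] exI[of _ 0]) auto
    qed
  qed
  ultimately show "is_subfield hull (insert s K) \<subseteq> ?S"
    by (intro hull_minimal)
qed

text \<open>Adjoin the roots one at a time. If \<open>x = a + b * s i\<close> over the smaller field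
  \<open>M\<close> and \<open>x\<close> is not in \<open>M\<close>, then
  \<open>2 * a * b * s i\<close> lies in \<open>M\<close> because the square of \<open>x\<close>
  does, which forces \<open>a = 0\<close>. Then \<open>x * s i\<close> lies in \<open>M\<close> and
  still has its square in \<open>K\<close>, so the induction hypothesis applies to it.\<close>

lemma kummer_quadratic:
  fixes s :: "'i \<Rightarrow> 'a::field_char_0"
  assumes K: "is_subfield K" and "finite I" and "\<And>i. i \<in> I \<Longrightarrow> (s i)\<^sup>2 \<in> K"
    and "x \<in> is_subfield hull (K \<union> s ` I)" and "x\<^sup>2 \<in> K"
  shows "\<exists>J\<subseteq>I. x * prod s J \<in> K"
  using assms(2-)
proof (induction I arbitrary: x rule: finite_induct)
  case empty
  then show ?case using hull_same[of is_subfield K] K by auto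
next
  case (insert i I)
  define M where "M = is_subfield hull (K \<union> s ` I)"
  have M: "is_subfield M" unfolding M_def by (rule is_subfield_hull)
  note MD = is_subfieldD[OF M]
  have KM: "K \<subseteq> M" unfolding M_def by (auto intro: hull_inc)
  have "is_subfield hull (K \<union> s ` insert i I) = is_subfield hull (insert (s i) M)"
    unfolding M_def by (subst hull_insert[symmetric]) simp
  moreover have "(s i)\<^sup>2 \<in> M" using insert.prems(1) KM by auto
  ultimately obtain a b where x: "x = a + b * s i" and ab: "a \<in> M" "b \<in> M"
    using hull_insert_sqrt[OF M, of "s i"] insert.prems(2) by auto
  have IH: "\<exists>J\<subseteq>I. y * prod s J \<in> K" if "y \<in> M" "y\<^sup>2 \<in> K" for y
    using insert.IH[of y] insert.prems(1) that M_def by auto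
  have si: "(s i)\<^sup>2 \<in> K" using insert.prems(1) by auto
  show ?case
  proof (cases "x \<in> M")
    case True
    then show ?thesis using IH insert.prems(3) by blast
  next
    case False
    then have b0: "b \<noteq> 0" and sM: "s i \<notin> M" using ab x by (auto simp: MD)
    have "x\<^sup>2 - a\<^sup>2 - b\<^sup>2 * (s i)\<^sup>2 = (2 * a * b) * s i"
      unfolding x by (simp add: algebra_simps power2_eq_square)
    moreover have "x\<^sup>2 - a\<^sup>2 - b\<^sup>2 * (s i)\<^sup>2 \<in> M"
      using insert.prems(3) KM si ab by (simp add: MD subsetD)
    ultimately have *: "(2 * a * b) * s i \<in> M" by simp
    have "a = 0"
    proof (rule ccontr)
      assume "a \<noteq> 0"
      then have "s i = (2 * a * b) * s i / (2 * a * b)" using b0 by simp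
      moreover have "2 * a * b \<in> M" using ab is_subfield_of_nat[OF M, of 2] by (simp add: MD)
      ultimately have "s i \<in> M" using MD(8)[OF *] by metis
      then show False using sM by simp
    qed
    then have "x * s i = b * (s i)\<^sup>2" using x by (simp add: power2_eq_square)
    then have "x * s i \<in> M" using ab si KM by (simp add: MD subsetD)
    moreover have "(x * s i)\<^sup>2 \<in> K"
      using insert.prems(3) si is_subfieldD(6)[OF K] by (simp add: power_mult_distrib)
    ultimately obtain J where J: "J \<subseteq> I" "x * s i * prod s J \<in> K" using IH by blast
    have "i \<notin> J" "finite J" using J insert.hyps finite_subset by auto
    then have "x * prod s (insert i J) \<in> K" using J by (simp add: mult.assoc)
    then show ?thesis using J by (intro exI[of _ "insert i J"]) auto
  qed
qed

section \<open>Homomorphisms of subfields and their extension along square roots\<close>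

definition field_hom :: "'a::field set \<Rightarrow> ('a \<Rightarrow> 'b::field) \<Rightarrow> bool"
  where "field_hom K \<sigma> \<longleftrightarrow> is_subfield K \<and> \<sigma> 1 = 1 \<and>
    (\<forall>x\<in>K. \<forall>y\<in>K. \<sigma> (x + y) = \<sigma> x + \<sigma> y \<and> \<sigma> (x * y) = \<sigma> x * \<sigma> y)"

lemma field_homD:
  assumes "field_hom K \<sigma>"
  shows "is_subfield K" "\<sigma> 0 = 0" "\<sigma> 1 = 1"
    "x \<in> K \<Longrightarrow> y \<in> K \<Longrightarrow> \<sigma> (x + y) = \<sigma> x + \<sigma> y"
    "x \<in> K \<Longrightarrow> y \<in> K \<Longrightarrow> \<sigma> (x * y) = \<sigma> x * \<sigma> y"
    "x \<in> K \<Longrightarrow> \<sigma> (- x) = - \<sigma> x" "x \<in> K \<Longrightarrow> \<sigma> (inverse x) = inverse (\<sigma> x)"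
    "x \<in> K \<Longrightarrow> y \<in> K \<Longrightarrow> \<sigma> (x - y) = \<sigma> x - \<sigma> y"
    "x \<in> K \<Longrightarrow> \<sigma> (x ^ n) = \<sigma> x ^ n"
    "x \<in> K \<Longrightarrow> \<sigma> x = 0 \<longleftrightarrow> x = 0"
proof -
  show K: "is_subfield K" and one: "\<sigma> 1 = 1"
    and add: "\<And>x y. x \<in> K \<Longrightarrow> y \<in> K \<Longrightarrow> \<sigma> (x + y) = \<sigma> x + \<sigma> y"
    and mult: "\<And>x y. x \<in> K \<Longrightarrow> y \<in> K \<Longrightarrow> \<sigma> (x * y) = \<sigma> x * \<sigma> y"
    using assms by (auto simp: field_hom_def)
  note KD = is_subfieldD[OF K]
  show zero: "\<sigma> 0 = 0" using add[OF KD(1) KD(1)] by (metis add_0 add_cancel_left_left)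
  show neg: "\<sigma> (- x) = - \<sigma> x" if "x \<in> K" for x
    using add[OF that KD(3)[OF that]] zero by (simp add: eq_neg_iff_add_eq_0 add.commute)
  show inv: "\<sigma> (inverse x) = inverse (\<sigma> x)" if "x \<in> K" for x
  proof (cases "x = 0")
    case False
    then have "\<sigma> x * \<sigma> (inverse x) = 1" using mult[OF that KD(4)[OF that]] one by simp
    then show ?thesis by (metis inverse_unique)
  qed (simp add: zero)
  show "x \<in> K \<Longrightarrow> y \<in> K \<Longrightarrow> \<sigma> (x - y) = \<sigma> x - \<sigma> y"
    using add[of x "- y"] neg[of y] KD(3) by simp
  show "x \<in> K \<Longrightarrow> \<sigma> (x ^ n) = \<sigma> x ^ n"
    by (induction n) (auto simp: one mult KD)
  show "x \<in> K \<Longrightarrow> \<sigma> x = 0 \<longleftrightarrow> x = 0"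
    using zero inv[of x] mult[of x "inverse x"] KD(4) one by (cases "x = 0") auto
qed

lemma field_hom_id: "is_subfield K \<Longrightarrow> field_hom K (\<lambda>x. x)"
  by (simp add: field_hom_def)

lemma field_hom_inj: "field_hom K \<sigma> \<Longrightarrow> inj_on \<sigma> K"
proof (rule inj_onI)
  fix x y assume h: "field_hom K \<sigma>" and xy: "x \<in> K" "y \<in> K" "\<sigma> x = \<sigma> y"
  then have "\<sigma> (x - y) = 0" by (simp add: field_homD(8)[OF h])
  moreover have "x - y \<in> K" using xy is_subfieldD(7)[OF field_homD(1)[OF h]] by simp
  ultimately show "x = y" using field_homD(10)[OF h] by simp
qed

lemma field_hom_of_int: "field_hom K \<sigma> \<Longrightarrow> \<sigma> (of_int n) = of_int n"
proof -
  assume h: "field_hom K \<sigma>"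
  have nat: "\<sigma> (of_nat n) = of_nat n" for n
    by (induction n)
      (auto simp: field_homD[OF h] is_subfieldD[OF field_homD(1)[OF h]]
        is_subfield_of_nat[OF field_homD(1)[OF h]])
  show ?thesis
    by (cases n rule: int_diff_cases)
      (auto simp: nat field_homD[OF h] is_subfield_of_nat[OF field_homD(1)[OF h]])
qed

lemma field_hom_Rats:
  assumes h: "field_hom K \<sigma>" and "x \<in> \<rat>"
  shows "\<sigma> x = (x :: 'a::field_char_0)"
proof -
  note K = field_homD(1)[OF h]
  obtain a b where "x = of_int a * inverse (of_int b)"
    using \<open>x \<in> \<rat>\<close> by (elim Rats_cases') (auto simp: divide_inverse)
  then show ?thesis
    by (simp add: field_homD[OF h] field_hom_of_int[OF h] is_subfield_of_int[OF K]
        is_subfieldD[OF K])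
qed

lemma field_hom_prod:
  "field_hom K \<sigma> \<Longrightarrow> (\<And>i. i \<in> I \<Longrightarrow> f i \<in> K) \<Longrightarrow> \<sigma> (prod f I) = (\<Prod>i\<in>I. \<sigma> (f i))"
  by (induction I rule: infinite_finite_induct)
    (auto simp: field_homD is_subfield_prod[OF field_homD(1)])

text \<open>Nothing is asked of \<open>\<sigma>\<close> outside its field, so one total function can
  serve on every smaller field of a tower.\<close>

lemma field_hom_mono: "field_hom L \<sigma> \<Longrightarrow> is_subfield K \<Longrightarrow> K \<subseteq> L \<Longrightarrow> field_hom K \<sigma>"
  unfolding field_hom_def by blast

text \<open>The elements that \<open>\<sigma>\<close> sends into \<open>L\<close> form a subfield,
  so it suffices to look at generators.\<close>

lemma field_hom_image_hull:
  assumes h: "field_hom (is_subfield hull A) \<sigma>" and "\<And>x. x \<in> A \<Longrightarrow> \<sigma> x \<in> L" and L: "is_subfield L"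
    and x: "x \<in> is_subfield hull A"
  shows "\<sigma> x \<in> L"
proof -
  let ?K = "is_subfield hull A"
  note K = is_subfieldD[OF is_subfield_hull[of A]]
  have "is_subfield {x \<in> ?K. \<sigma> x \<in> L}"
    by (rule is_subfieldI) (auto simp: field_homD[OF h] K is_subfieldD[OF L])
  then have "?K \<subseteq> {x \<in> ?K. \<sigma> x \<in> L}"
    using assms(2) by (intro hull_minimal) (auto intro: hull_inc)
  then show ?thesis using x by blast
qed

text \<open>The equaliser of two homomorphisms is a subfield.\<close>

lemma field_hom_eq_hull:
  assumes h: "field_hom (is_subfield hull A) \<sigma>" "field_hom (is_subfield hull A) \<tau>"
    and "\<And>x. x \<in> A \<Longrightarrow> \<sigma> x = \<tau> x" and x: "x \<in> is_subfield hull A"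
  shows "\<sigma> x = \<tau> x"
proof -
  let ?K = "is_subfield hull A"
  note K = is_subfieldD[OF is_subfield_hull[of A]]
  have "is_subfield {x \<in> ?K. \<sigma> x = \<tau> x}"
    by (rule is_subfieldI) (auto simp: field_homD[OF h(1)] field_homD[OF h(2)] K)
  then have "?K \<subseteq> {x \<in> ?K. \<sigma> x = \<tau> x}"
    using assms(3) by (intro hull_minimal) (auto intro: hull_inc)
  then show ?thesis using x by blast
qed

text \<open>The extension is \<open>a + b * s \<mapsto> \<sigma> a + \<sigma> b * t\<close>. It is
  well defined because coordinates are unique for \<open>s \<notin> K\<close>, and multiplicative
  because \<open>t\<close> satisfies the image of the equation of \<open>s\<close>.\<close>

lemma field_hom_extend_sqrt:
  fixes s :: "'a::field" and t :: "'b::field"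
  assumes h: "field_hom K \<sigma>" and s2: "s\<^sup>2 \<in> K" and s: "s \<notin> K" and t: "t\<^sup>2 = \<sigma> (s\<^sup>2)"
  shows "\<exists>\<tau>. field_hom (is_subfield hull (insert s K)) \<tau> \<and> (\<forall>x\<in>K. \<tau> x = \<sigma> x) \<and> \<tau> s = t"
proof -
  note K = field_homD(1)[OF h]
  note KD = is_subfieldD[OF K] and hD = field_homD[OF h]
  note H = hull_insert_sqrt[OF K s2]
  define P where "P x ab \<longleftrightarrow> fst ab \<in> K \<and> snd ab \<in> K \<and> x = fst ab + snd ab * s" for x ab
  define \<tau> where "\<tau> x = (let ab = SOME ab. P x ab in \<sigma> (fst ab) + \<sigma> (snd ab) * t)" for x
  have uniq: "a = a' \<and> b = b'" if "a + b * s = a' + b' * s" "a \<in> K" "b \<in> K" "a' \<in> K" "b' \<in> K"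
    for a b a' b'
  proof -
    have eq: "(b - b') * s = a' - a" using that(1) by (simp add: algebra_simps)
    have "b = b'"
    proof (rule ccontr)
      assume "b \<noteq> b'"
      then have "s = (a' - a) / (b - b')" using eq by (simp add: field_simps)
      then show False using s that KD(7,8) by simp
    qed
    then show ?thesis using that(1) by simp
  qed
  have \<tau>: "\<tau> (a + b * s) = \<sigma> a + \<sigma> b * t" if "a \<in> K" "b \<in> K" for a b
  proof -
    have "P (a + b * s) ab \<longleftrightarrow> ab = (a, b)" for ab
      unfolding P_def using that uniq[of a b "fst ab" "snd ab"] by (cases ab) auto
    then show ?thesis by (simp add: \<tau>_def)
  qed
  have "field_hom (is_subfield hull (insert s K)) \<tau>"
    unfolding field_hom_def
  proof (intro conjI ballI is_subfield_hull)
    show "\<tau> 1 = 1" using \<tau>[OF KD(2) KD(1)] hD by simp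
  next
    fix x y assume "x \<in> is_subfield hull (insert s K)" "y \<in> is_subfield hull (insert s K)"
    then obtain a b a' b' where x: "x = a + b * s" "a \<in> K" "b \<in> K"
      and y: "y = a' + b' * s" "a' \<in> K" "b' \<in> K" unfolding H by blast
    have "x + y = (a + a') + (b + b') * s" using x y by (simp add: algebra_simps)
    then have "\<tau> (x + y) = \<sigma> (a + a') + \<sigma> (b + b') * t"
      using x y \<tau>[of "a + a'" "b + b'"] by (metis KD(5))
    then show "\<tau> (x + y) = \<tau> x + \<tau> y"
      using x y by (simp add: \<tau> hD algebra_simps)
    have "x * y = (a * a' + b * b' * s\<^sup>2) + (a * b' + b * a') * s"
      using x y by (simp add: algebra_simps power2_eq_square)
    moreover have "\<tau> \<dots> = \<sigma> (a * a' + b * b' * s\<^sup>2) + \<sigma> (a * b' + b * a') * t"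
      using x y s2 by (intro \<tau>) (simp_all add: KD)
    moreover have "\<dots> = (\<sigma> a * \<sigma> a' + \<sigma> b * \<sigma> b' * t\<^sup>2) + (\<sigma> a * \<sigma> b' + \<sigma> b * \<sigma> a') * t"
      using x y s2 by (simp add: KD(1-8) hD(1-8) t)
    ultimately show "\<tau> (x * y) = \<tau> x * \<tau> y"
      using x y by (simp add: \<tau> algebra_simps power2_eq_square)
  qed
  moreover have "\<tau> x = \<sigma> x" if "x \<in> K" for x
    using \<tau>[OF that KD(1)] hD by simp
  moreover have "\<tau> s = t" using \<tau>[OF KD(1,2)] hD by simp
  ultimately show ?thesis by blast
qed

text \<open>Independence lets the images of the roots be prescribed separately: if
  \<open>s i\<close> already lay in the field generated by the earlier roots,
  \<open>kummer_quadratic\<close> would put a nonempty product of roots into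
  \<open>K\<close>.\<close>

lemma field_hom_extend_sqrts:
  fixes s :: "'i \<Rightarrow> 'a::field_char_0" and t :: "'i \<Rightarrow> 'b::field"
  assumes h: "field_hom K \<sigma>" and "finite I" and "\<And>i. i \<in> I \<Longrightarrow> (s i)\<^sup>2 \<in> K"
    and "\<And>J. J \<subseteq> I \<Longrightarrow> J \<noteq> {} \<Longrightarrow> prod s J \<notin> K"
    and "\<And>i. i \<in> I \<Longrightarrow> (t i)\<^sup>2 = \<sigma> ((s i)\<^sup>2)"
  shows "\<exists>\<tau>. field_hom (is_subfield hull (K \<union> s ` I)) \<tau> \<and> (\<forall>x\<in>K. \<tau> x = \<sigma> x) \<and>
    (\<forall>i\<in>I. \<tau> (s i) = t i)"
  using assms(2-)
proof (induction I rule: finite_induct)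
  case empty
  then show ?case using h hull_same[of is_subfield K] field_homD(1)[OF h] by auto
next
  case (insert i I)
  note K = field_homD(1)[OF h]
  define M where "M = is_subfield hull (K \<union> s ` I)"
  have "\<exists>\<tau>. field_hom M \<tau> \<and> (\<forall>x\<in>K. \<tau> x = \<sigma> x) \<and> (\<forall>i\<in>I. \<tau> (s i) = t i)"
    unfolding M_def using insert.prems by (intro insert.IH) (auto simp: subset_insertI2)
  then obtain \<tau> where \<tau>: "field_hom M \<tau>" "\<And>x. x \<in> K \<Longrightarrow> \<tau> x = \<sigma> x"
    "\<And>i. i \<in> I \<Longrightarrow> \<tau> (s i) = t i" by blast
  have KM: "K \<subseteq> M" and sM: "\<And>i. i \<in> I \<Longrightarrow> s i \<in> M" unfolding M_def by (auto intro: hull_inc)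
  have eq: "is_subfield hull (K \<union> s ` insert i I) = is_subfield hull (insert (s i) M)"
    unfolding M_def by (subst hull_insert[symmetric]) simp
  have "s i \<notin> M"
  proof
    assume "s i \<in> M"
    then obtain J where J: "J \<subseteq> I" "s i * prod s J \<in> K"
      using kummer_quadratic[OF K insert.hyps(1), of s "s i"] insert.prems(1) M_def by auto
    have "i \<notin> J" "finite J" using J insert.hyps finite_subset by auto
    then have "prod s (insert i J) \<in> K" using J by simp
    then show False using insert.prems(2)[of "insert i J"] J by auto
  qed
  moreover have "(s i)\<^sup>2 \<in> K" "(t i)\<^sup>2 = \<tau> ((s i)\<^sup>2)" using insert.prems(1,3) \<tau>(2) by auto
  ultimately obtain \<tau>' where \<tau>': "field_hom (is_subfield hull (insert (s i) M)) \<tau>'"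
    "\<And>x. x \<in> M \<Longrightarrow> \<tau>' x = \<tau> x" "\<tau>' (s i) = t i"
    using field_hom_extend_sqrt[OF \<tau>(1), of "s i" "t i"] KM by blast
  show ?case unfolding eq
    using \<tau>' \<tau> KM sM by (intro exI[of _ \<tau>']) auto
qed

section \<open>Squares and products\<close>

text \<open>Modulo squares, products over subsets multiply by symmetric difference of the index
  sets.\<close>

lemma prod_mult_prod_sym_diff:
  fixes f :: "'a \<Rightarrow> 'b::comm_monoid_mult"
  assumes "finite A" "finite B"
  shows "prod f A * prod f B = prod f ((A - B) \<union> (B - A)) * (prod f (A \<inter> B))\<^sup>2"
proof -
  have "prod f A = prod f (A - B) * prod f (A \<inter> B)"
    using prod.Int_Diff[OF assms(1), of f B] by (simp add: mult.commute)
  moreover have "prod f B = prod f (B - A) * prod f (A \<inter> B)"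
    using prod.Int_Diff[OF assms(2), of f A] by (simp add: mult.commute Int_commute)
  moreover have "prod f ((A - B) \<union> (B - A)) = prod f (A - B) * prod f (B - A)"
    using assms by (intro prod.union_disjoint) auto
  ultimately show ?thesis by (simp add: power2_eq_square ac_simps)
qed

text \<open>In lowest terms the square of the denominator divides the square of the numerator, so
  the denominator is 1.\<close>

lemma int_square_if_Rats_square:
  fixes x :: "'a::field_char_0"
  assumes "x \<in> \<rat>" "x\<^sup>2 = of_int n"
  shows "\<exists>z. z\<^sup>2 = n"
proof -
  obtain u v where uv: "v > 0" "coprime u v" "x = of_int u / of_int v"
    using assms(1) by (rule Rats_cases')
  then have "x * of_int v = of_int u" by simp
  then have "(x * of_int v)\<^sup>2 = (of_int u)\<^sup>2" by simp
  then have "of_int (u\<^sup>2) = (of_int (n * v\<^sup>2) :: 'a)"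
    using assms(2) by (simp add: power_mult_distrib)
  then have eq: "u\<^sup>2 = n * v\<^sup>2" by (simp only: of_int_eq_iff)
  have "coprime (v\<^sup>2) (u\<^sup>2)" using uv(2) by (simp add: coprime_commute)
  moreover have "v\<^sup>2 dvd u\<^sup>2" unfolding eq by simp
  ultimately have "is_unit (v\<^sup>2)" using coprime_common_divisor dvd_refl by blast
  then have "v\<^sup>2 = 1" using uv(1) by (simp add: is_unit_power_iff)
  then show ?thesis using eq by auto
qed

text \<open>Unique factorisation applied to absolute values. The sign stays open because
  \<open>m\<close> and \<open>n\<close> may both be negative.\<close>

lemma square_if_coprime_mult_square:
  fixes m n z :: int
  assumes "z\<^sup>2 = m * n" "coprime m n"
  shows "\<exists>y. y\<^sup>2 = m \<or> - (y\<^sup>2) = m"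
proof -
  have "nat \<bar>m\<bar> * nat \<bar>n\<bar> = (nat \<bar>z\<bar>)\<^sup>2"
    using assms(1) by (metis abs_mult abs_power2 nat_abs_mult_distrib power2_eq_square)
  moreover have "coprime (nat \<bar>m\<bar>) (nat \<bar>n\<bar>)" using assms(2) by (simp add: coprime_int_iff[symmetric])
  ultimately have "is_nth_power 2 (nat \<bar>m\<bar>)"
    using is_nth_power_mult_coprime_nat_iff[of "nat \<bar>m\<bar>" "nat \<bar>n\<bar>" 2] by (metis is_nth_power_def)
  then obtain y where "nat \<bar>m\<bar> = y\<^sup>2" by (auto simp: is_nth_power_def)
  then have "\<bar>m\<bar> = (int y)\<^sup>2" by (metis abs_ge_zero nat_eq_iff2 of_nat_power)
  then show ?thesis by (metis abs_eq_iff' abs_if minus_minus)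
qed

section \<open>The tower of iterated preimages of 0\<close>

locale quadratic_tree =
  fixes c :: int
begin

abbreviation C :: complex
  where "C \<equiv> of_int c"

definition q :: "complex \<Rightarrow> complex"
  where "q z = z\<^sup>2 + C"

definition R :: "nat \<Rightarrow> complex set"
  where "R k = {z. (q ^^ k) z = 0}"

text \<open>Every subfield of the complex numbers contains the rationals, so the roots alone
  generate the splitting field.\<close>

definition K :: "nat \<Rightarrow> complex set"
  where "K k = is_subfield hull (R k)"

text \<open>A fixed section of \<open>q\<close>: the fibre over \<open>\<gamma>\<close> consists of
  \<open>s \<gamma>\<close> and \<open>- s \<gamma>\<close>.\<close>

definition s :: "complex \<Rightarrow> complex"
  where "s \<gamma> = csqrt (\<gamma> - C)"

definition a :: "nat \<Rightarrow> int"
  where "a k = ((\<lambda>x. x\<^sup>2 + c) ^^ k) 0"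

text \<open>As \<open>prod s J\<close> is a square root of the product of
  \<open>\<gamma> - C\<close> over \<open>J\<close>, this is linear independence over the field with
  two elements of the \<open>\<gamma> - C\<close> in the nonzero elements of \<open>K k\<close>
  modulo squares. The set \<open>{C}\<close> shows that it forces
  \<open>C \<notin> R k\<close>.\<close>

definition indep :: "nat \<Rightarrow> bool"
  where "indep k \<longleftrightarrow> (\<forall>J\<subseteq>R k. J \<noteq> {} \<longrightarrow> prod s J \<notin> K k)"

text \<open>As \<open>C\<close> is the critical value of \<open>q\<close>, this says that every vertex below level \<open>k\<close> has two
  preimages.\<close>

definition sep :: "nat \<Rightarrow> bool"
  where "sep k \<longleftrightarrow> (\<forall>j<k. C \<notin> R j)"

lemma R_0: "R 0 = {0}"
  by (auto simp: R_def)

lemma R_Suc: "z \<in> R (Suc k) \<longleftrightarrow> q z \<in> R k"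
  by (simp add: R_def funpow_Suc_right del: funpow.simps)

lemma s_square: "(s \<gamma>)\<^sup>2 = \<gamma> - C"
  by (simp add: s_def)

lemma q_s [simp]: "q (s \<gamma>) = \<gamma>"
  by (simp add: q_def s_square)

lemma q_minus [simp]: "q (- z) = q z"
  by (simp add: q_def)

lemma q_eq_iff: "q x = q y \<longleftrightarrow> x = y \<or> x = - y"
  by (simp add: q_def power2_eq_iff)

lemma q_fibre: "q x = \<gamma> \<longleftrightarrow> x = s \<gamma> \<or> x = - s \<gamma>"
  using q_eq_iff[of x "s \<gamma>"] by simp

lemma s_eq_0_iff: "s \<gamma> = 0 \<longleftrightarrow> \<gamma> = C"
  by (simp add: s_def)

lemma q_vimage: "{\<beta>. q \<beta> \<in> J} = s ` J \<union> (\<lambda>\<gamma>. - s \<gamma>) ` J"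
proof (intro equalityI subsetI)
  fix \<beta> assume "\<beta> \<in> {\<beta>. q \<beta> \<in> J}"
  moreover have "\<beta> = s (q \<beta>) \<or> \<beta> = - s (q \<beta>)" using q_fibre[of \<beta> "q \<beta>"] by simp
  ultimately show "\<beta> \<in> s ` J \<union> (\<lambda>\<gamma>. - s \<gamma>) ` J" by blast
qed auto

lemma R_Suc_eq: "R (Suc k) = s ` R k \<union> (\<lambda>\<gamma>. - s \<gamma>) ` R k"
  unfolding q_vimage[symmetric] using R_Suc by blast

lemma finite_R: "finite (R k)"
  by (induction k) (auto simp: R_0 R_Suc_eq)

section \<open>Counting the roots on each level\<close>

lemma inj_s: "inj s"
  by (metis injI q_s)

text \<open>The two points \<open>s \<gamma>\<close> and \<open>- s \<gamma>\<close> coincide only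
  for \<open>\<gamma> = C\<close>, so each level doubles the previous one.\<close>

lemma card_R:
  assumes "sep k"
  shows "card (R k) = 2 ^ k"
  using assms
proof (induction k)
  case 0
  then show ?case by (simp add: R_0)
next
  case (Suc k)
  then have C: "C \<notin> R k" and IH: "card (R k) = 2 ^ k" by (auto simp: sep_def)
  have inj: "inj (\<lambda>\<gamma>. - s \<gamma>)" using inj_s by (simp add: inj_def)
  have "s ` R k \<inter> (\<lambda>\<gamma>. - s \<gamma>) ` R k = {}"
  proof -
    have "s \<gamma> \<noteq> - s \<delta>" if "\<gamma> \<in> R k" for \<gamma> \<delta>
    proof
      assume eq: "s \<gamma> = - s \<delta>"
      then have "\<gamma> = \<delta>" by (metis q_minus q_s)
      then have "s \<gamma> = 0" using eq by simp
      then show False using C that s_eq_0_iff by simp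
    qed
    then show ?thesis by blast
  qed
  then have "card (R (Suc k)) = card (R k) + card (R k)"
    unfolding R_Suc_eq using finite_R
    by (subst card_Un_disjoint) (auto simp: card_image inj_on_subset[OF inj] inj_on_subset[OF inj_s])
  then show ?case using IH by simp
qed

lemma card_R_Suc_le: "card (R (Suc k)) \<le> 2 * card (R k)"
proof -
  have "card (R (Suc k)) \<le> card (s ` R k) + card ((\<lambda>\<gamma>. - s \<gamma>) ` R k)"
    unfolding R_Suc_eq by (rule card_Un_le)
  then show ?thesis using card_image_le[OF finite_R, of s k] card_image_le[OF finite_R, of "\<lambda>\<gamma>. - s \<gamma>" k]
    by linarith
qed

text \<open>The only preimage of the critical value \<open>C\<close> is 0, so one point is
  lost.\<close>

lemma card_R_Suc_less:
  assumes "C \<in> R k"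
  shows "card (R (Suc k)) < 2 * card (R k)"
proof -
  have "s C = 0" by (simp add: s_eq_0_iff)
  then have "(\<lambda>\<gamma>. - s \<gamma>) ` R k \<subseteq> s ` R k \<union> (\<lambda>\<gamma>. - s \<gamma>) ` (R k - {C})"
    using assms by (smt (verit) Diff_iff UnCI add.inverse_neutral image_iff image_subset_iff singletonD)
  then have "R (Suc k) = s ` R k \<union> (\<lambda>\<gamma>. - s \<gamma>) ` (R k - {C})"
    unfolding R_Suc_eq by blast
  then have "card (R (Suc k)) \<le> card (s ` R k) + card ((\<lambda>\<gamma>. - s \<gamma>) ` (R k - {C}))"
    by (metis card_Un_le)
  moreover have "card (s ` R k) \<le> card (R k)"
    "card ((\<lambda>\<gamma>. - s \<gamma>) ` (R k - {C})) \<le> card (R k - {C})"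
    using finite_R by (auto intro!: card_image_le)
  moreover have "card (R k - {C}) < card (R k)"
    using assms finite_R by (intro psubset_card_mono) auto
  ultimately show ?thesis by linarith
qed

text \<open>The count at most doubles per level, and strictly less than doubles at a level
  containing \<open>C\<close>; the maximal count at level \<open>k\<close> therefore excludes any
  loss below.\<close>

lemma sep_if_card_R:
  assumes "card (R k) = 2 ^ k"
  shows "sep k"
  using assms
proof (induction k)
  case 0
  then show ?case by (simp add: sep_def)
next
  case (Suc k)
  have "card (R j) \<le> 2 ^ j" for j
  proof (induction j)
    case 0
    then show ?case by (simp add: R_0)
  next
    case (Suc j)
    then show ?case using card_R_Suc_le[of j] by simp
  qed
  from this[of k] have "card (R k) = 2 ^ k" "C \<notin> R k"
    using Suc.prems card_R_Suc_le[of k] card_R_Suc_less[of k] by auto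
  then show ?case using Suc.IH less_Suc_eq by (auto simp: sep_def)
qed

lemma sep_mono: "sep k \<Longrightarrow> j \<le> k \<Longrightarrow> sep j"
  by (auto simp: sep_def)

text \<open>Because \<open>C = q 0\<close>, the index of \<open>a\<close> runs one ahead of the
  level.\<close>

lemma iterate_C: "(q ^^ k) C = of_int (a (Suc k))"
proof -
  have "(q ^^ k) 0 = of_int (a k)" for k
    by (induction k) (auto simp: a_def q_def)
  moreover have "(q ^^ Suc k) 0 = (q ^^ k) C"
    by (simp add: funpow_Suc_right q_def del: funpow.simps)
  ultimately show ?thesis by metis
qed

lemma C_in_R_iff: "C \<in> R k \<longleftrightarrow> a (Suc k) = 0"
  by (simp add: R_def iterate_C)

section \<open>The tower of splitting fields\<close>

lemma K_subfield: "is_subfield (K k)"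
  unfolding K_def by (rule is_subfield_hull)

lemmas KD = is_subfieldD[OF K_subfield]

lemma C_in_K: "C \<in> K k"
  by (rule is_subfield_of_int[OF K_subfield])

lemma R_subset_K: "R k \<subseteq> K k"
  unfolding K_def by (rule hull_subset)

lemma q_in_K: "z \<in> K k \<Longrightarrow> q z \<in> K k"
  unfolding q_def by (simp add: KD C_in_K)

text \<open>A root \<open>z\<close> is recovered from the next level as
  \<open>q (s z)\<close>.\<close>

lemma R_subset_K_Suc: "R k \<subseteq> K (Suc k)"
proof
  fix z assume "z \<in> R k"
  then have "s z \<in> K (Suc k)" using R_subset_K[of "Suc k"] R_Suc[of "s z" k] by auto
  then show "z \<in> K (Suc k)" using q_in_K[of "s z"] by simp
qed

lemma K_subset_K_Suc: "K k \<subseteq> K (Suc k)"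
  unfolding K_def[of k] by (intro hull_minimal R_subset_K_Suc K_subfield)

lemma K_mono: "j \<le> k \<Longrightarrow> K j \<subseteq> K k"
  by (rule lift_Suc_mono_le[of K, OF K_subset_K_Suc])

lemma s_in_K_Suc: "\<gamma> \<in> R k \<Longrightarrow> s \<gamma> \<in> K (Suc k)"
  using R_subset_K[of "Suc k"] R_Suc[of "s \<gamma>" k] by auto

lemma s_square_in_K: "\<gamma> \<in> R k \<Longrightarrow> (s \<gamma>)\<^sup>2 \<in> K k"
  unfolding s_square using R_subset_K[of k] C_in_K by (intro KD(7)) auto

text \<open>This presents each step of the tower as a multiquadratic extension, the form in which
  the Kummer lemmas apply.\<close>

lemma K_Suc_eq: "K (Suc k) = is_subfield hull (K k \<union> s ` R k)"
proof
  let ?H = "is_subfield hull (K k \<union> s ` R k)"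
  have "s \<gamma> \<in> ?H" "- s \<gamma> \<in> ?H" if "\<gamma> \<in> R k" for \<gamma>
    using that by (auto intro!: is_subfieldD(3)[OF is_subfield_hull] intro: hull_inc)
  then show "K (Suc k) \<subseteq> ?H"
    unfolding K_def[of "Suc k"] R_Suc_eq by (intro hull_minimal is_subfield_hull) auto
  show "?H \<subseteq> K (Suc k)"
    using K_subset_K_Suc s_in_K_Suc by (intro hull_minimal K_subfield) auto
qed

lemma K_0: "K 0 = \<rat>"
proof
  have "is_subfield (\<rat> :: complex set)" by (rule is_subfieldI) auto
  then show "K 0 \<subseteq> \<rat>" unfolding K_def R_0 by (intro hull_minimal) auto
  show "\<rat> \<subseteq> K 0" by (rule is_subfield_Rats[OF K_subfield])
qed

section \<open>Homomorphisms of the tower: extension, transitivity and flips\<close>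

lemma hom_q:
  assumes "field_hom (K k) \<sigma>" "z \<in> K k"
  shows "\<sigma> (q z) = q (\<sigma> z)"
proof -
  have "\<sigma> (z\<^sup>2 + C) = \<sigma> (z\<^sup>2) + \<sigma> C"
    by (rule field_homD(4)[OF assms(1) KD(9)[OF assms(2)] C_in_K])
  then show ?thesis
    by (simp add: q_def field_homD(9)[OF assms] field_hom_of_int[OF assms(1)])
qed

lemma hom_R:
  assumes h: "field_hom (K k) \<sigma>" and "z \<in> K k" "z \<in> R j"
  shows "\<sigma> z \<in> R j"
  using assms(2-)
proof (induction j arbitrary: z)
  case 0
  then show ?case by (simp add: R_0 field_homD[OF h])
next
  case (Suc j)
  then show ?case using hom_q[OF h, of z] q_in_K R_Suc by metis
qed

lemma hom_K:
  assumes h: "field_hom (K k) \<sigma>" and "z \<in> K k"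
  shows "\<sigma> z \<in> K k"
proof (rule field_hom_image_hull[where A = "R k", folded K_def, OF h _ K_subfield \<open>z \<in> K k\<close>])
  fix x assume "x \<in> R k"
  then show "\<sigma> x \<in> K k" using hom_R[OF h, of x k] R_subset_K[of k] by blast
qed

lemma hom_R_image:
  assumes h: "field_hom (K k) \<sigma>"
  shows "\<sigma> ` R k = R k"
proof -
  have "inj_on \<sigma> (R k)" using field_hom_inj[OF h] R_subset_K inj_on_subset by blast
  moreover have "\<sigma> ` R k \<subseteq> R k" using hom_R[OF h] R_subset_K by blast
  ultimately show ?thesis using finite_R endo_inj_surj by blast
qed

text \<open>The condition on \<open>t\<close> says that \<open>t \<gamma>\<close> is one of the two
  square roots of \<open>\<sigma> \<gamma> - C\<close>; under \<open>indep k\<close> all these signs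
  are free.\<close>

lemma hom_extend:
  assumes "indep k" and h: "field_hom (K k) \<sigma>"
    and "\<And>\<gamma>. \<gamma> \<in> R k \<Longrightarrow> q (t \<gamma>) = \<sigma> \<gamma>"
  shows "\<exists>\<tau>. field_hom (K (Suc k)) \<tau> \<and> (\<forall>x\<in>K k. \<tau> x = \<sigma> x) \<and> (\<forall>\<gamma>\<in>R k. \<tau> (s \<gamma>) = t \<gamma>)"
proof -
  have 1: "(t \<gamma>)\<^sup>2 = \<sigma> ((s \<gamma>)\<^sup>2)" if "\<gamma> \<in> R k" for \<gamma>
  proof -
    have "\<sigma> (\<gamma> - C) = \<sigma> \<gamma> - C"
      using that R_subset_K field_homD(8)[OF h _ C_in_K] field_hom_of_int[OF h] by auto
    moreover have "(t \<gamma>)\<^sup>2 = \<sigma> \<gamma> - C" using assms(3)[OF that] by (simp add: q_def eq_diff_eq)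
    ultimately show ?thesis unfolding s_square by simp
  qed
  have 2: "prod s J \<notin> K k" if "J \<subseteq> R k" "J \<noteq> {}" for J
    using assms(1) that by (simp add: indep_def)
  show ?thesis
    unfolding K_Suc_eq by (rule field_hom_extend_sqrts[OF h finite_R s_square_in_K 2 1])
qed

lemma hom_extend_many:
  fixes \<sigma> :: "complex \<Rightarrow> complex"
  assumes "k \<le> m" and "\<And>i. k \<le> i \<Longrightarrow> i < m \<Longrightarrow> indep i" and "field_hom (K k) \<sigma>"
  shows "\<exists>\<tau>. field_hom (K m) \<tau> \<and> (\<forall>x\<in>K k. \<tau> x = \<sigma> x)"
  using assms
proof (induction m rule: dec_induct)
  case base
  then show ?case by blast
next
  case (step m)
  then obtain \<tau> where \<tau>: "field_hom (K m) \<tau>" "\<forall>x\<in>K k. \<tau> x = \<sigma> x" by auto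
  have "indep m" using step.prems(1) step.hyps by simp
  \<comment> \<open>Any lift will do here; \<open>s (\<tau> \<gamma>)\<close> picks one.\<close>
  then obtain \<tau>' where "field_hom (K (Suc m)) \<tau>'" "\<forall>x\<in>K m. \<tau>' x = \<tau> x"
    using hom_extend[of m \<tau> "\<lambda>\<gamma>. s (\<tau> \<gamma>)"] \<tau>(1) q_s by blast
  then show ?case using \<tau>(2) K_mono[OF step.hyps(1)] by (intro exI[of _ \<tau>']) auto
qed

text \<open>Lift a homomorphism carrying \<open>q \<alpha>\<close> to \<open>q \<beta>\<close>,
  choosing the sign over \<open>q \<alpha>\<close> so that \<open>\<alpha>\<close> goes to
  \<open>\<beta>\<close>.\<close>

lemma hom_transitive:
  assumes "\<And>i. i < k \<Longrightarrow> indep i" "\<alpha> \<in> R k" "\<beta> \<in> R k"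
  shows "\<exists>\<sigma>. field_hom (K k) \<sigma> \<and> \<sigma> \<alpha> = \<beta>"
  using assms
proof (induction k arbitrary: \<alpha> \<beta>)
  case 0
  then show ?case using field_hom_id[OF K_subfield] by (auto simp: R_0)
next
  case (Suc k)
  have q: "q \<alpha> \<in> R k" "q \<beta> \<in> R k" using Suc.prems R_Suc by blast+
  then obtain \<sigma> where \<sigma>: "field_hom (K k) \<sigma>" "\<sigma> (q \<alpha>) = q \<beta>"
    using Suc.IH Suc.prems(1) less_Suc_eq by metis
  \<comment> \<open>The image is prescribed for \<open>s (q \<alpha>)\<close>, which is
    \<open>\<alpha>\<close> or \<open>- \<alpha>\<close>; hence \<open>\<beta>\<close> or
    \<open>- \<beta>\<close>.\<close>
  define t where "t \<gamma> = (if \<gamma> = q \<alpha> then (if \<alpha> = s \<gamma> then \<beta> else - \<beta>) else s (\<sigma> \<gamma>))" for \<gamma>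
  have "q (t \<gamma>) = \<sigma> \<gamma>" for \<gamma> using \<sigma>(2) by (simp add: t_def)
  then obtain \<tau> where \<tau>: "field_hom (K (Suc k)) \<tau>" "\<tau> (s (q \<alpha>)) = t (q \<alpha>)"
    using hom_extend[OF Suc.prems(1)[of k] \<sigma>(1), of t] q(1) by auto
  have "\<tau> \<alpha> = \<beta>"
  proof (cases "\<alpha> = s (q \<alpha>)")
    case True
    then show ?thesis using \<tau>(2) by (simp add: t_def)
  next
    case False
    then have "\<alpha> = - s (q \<alpha>)" using q_fibre by blast
    then have "\<tau> \<alpha> = - \<tau> (s (q \<alpha>))"
      using field_homD(6)[OF \<tau>(1) s_in_K_Suc[OF q(1)]] by simp
    then show ?thesis using False \<tau>(2) by (simp add: t_def)
  qed
  then show ?case using \<tau>(1) by blast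
qed

text \<open>Lift the identity of \<open>K j\<close> with a sign change only at
  \<open>s (q \<alpha>)\<close>, then extend arbitrarily to \<open>K m\<close>. The action is
  controlled only up to level \<open>j + 1\<close>.\<close>

lemma hom_flip:
  assumes ind: "\<And>i. i < m \<Longrightarrow> indep i" and "j < m" and \<alpha>: "\<alpha> \<in> R (Suc j)"
  obtains \<tau> where "field_hom (K m) \<tau>" "\<tau> \<alpha> = - \<alpha>" "\<tau> (- \<alpha>) = \<alpha>"
    "\<And>\<beta>. \<beta> \<in> R (Suc j) \<Longrightarrow> q \<beta> \<noteq> q \<alpha> \<Longrightarrow> \<tau> \<beta> = \<beta>"
proof -
  define t where "t \<gamma> = (if \<gamma> = q \<alpha> then - s \<gamma> else s \<gamma>)" for \<gamma>
  have "q (t \<gamma>) = \<gamma>" for \<gamma> by (simp add: t_def)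
  then obtain \<sigma> where \<sigma>: "field_hom (K (Suc j)) \<sigma>" "\<And>\<gamma>. \<gamma> \<in> R j \<Longrightarrow> \<sigma> (s \<gamma>) = t \<gamma>"
    using hom_extend[OF ind[OF \<open>j < m\<close>] field_hom_id[OF K_subfield], of t] by auto
  obtain \<tau> where \<tau>: "field_hom (K m) \<tau>" "\<forall>x\<in>K (Suc j). \<tau> x = \<sigma> x"
    using hom_extend_many[of "Suc j" m \<sigma>] ind \<open>j < m\<close> \<sigma>(1) by auto
  have \<tau>s: "\<tau> (s \<gamma>) = t \<gamma>" "\<tau> (- s \<gamma>) = - t \<gamma>" if "\<gamma> \<in> R j" for \<gamma>
    using s_in_K_Suc[OF that] \<tau>(2) \<sigma>(2)[OF that] KD(3)[OF s_in_K_Suc[OF that]]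
      field_homD(6)[OF \<sigma>(1) s_in_K_Suc[OF that]] by auto
  show ?thesis
  proof
    show "field_hom (K m) \<tau>" by fact
    have "\<alpha> = s (q \<alpha>) \<or> \<alpha> = - s (q \<alpha>)" using q_fibre by blast
    moreover have "\<tau> (s (q \<alpha>)) = - s (q \<alpha>)" "\<tau> (- s (q \<alpha>)) = s (q \<alpha>)"
      using \<tau>s[of "q \<alpha>"] \<alpha> by (auto simp: R_Suc t_def)
    ultimately show "\<tau> \<alpha> = - \<alpha>" "\<tau> (- \<alpha>) = \<alpha>"
      by (metis minus_minus)+
    show "\<tau> \<beta> = \<beta>" if "\<beta> \<in> R (Suc j)" "q \<beta> \<noteq> q \<alpha>" for \<beta>
    proof -
      have "\<beta> = s (q \<beta>) \<or> \<beta> = - s (q \<beta>)" using q_fibre by blast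
      moreover have "\<tau> (s (q \<beta>)) = s (q \<beta>)" "\<tau> (- s (q \<beta>)) = - s (q \<beta>)"
        using \<tau>s[of "q \<beta>"] that by (auto simp: R_Suc t_def)
      ultimately show ?thesis by metis
    qed
  qed
qed

section \<open>Dependencies and squares\<close>

text \<open>Excluding \<open>C\<close> from \<open>J\<close> makes every fibre consist of two
  distinct points.\<close>

lemma prod_fibres:
  fixes g :: "complex \<Rightarrow> 'b::comm_monoid_mult"
  assumes "finite J" "C \<notin> J"
  shows "(\<Prod>\<beta>\<in>{\<beta>. q \<beta> \<in> J}. g \<beta>) = (\<Prod>\<gamma>\<in>J. g (s \<gamma>) * g (- s \<gamma>))"
  using assms
proof (induction J rule: finite_induct)
  case empty
  then show ?case by simp
next
  case (insert \<gamma> J)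
  let ?B = "{\<beta>. q \<beta> \<in> J}"
  have "finite ?B" unfolding q_vimage using insert.hyps by simp
  moreover have "{\<beta>. q \<beta> \<in> insert \<gamma> J} = insert (s \<gamma>) (insert (- s \<gamma>) ?B)"
    by (auto simp: q_fibre)
  moreover have "s \<gamma> \<noteq> - s \<gamma>" using insert.prems s_eq_0_iff[of \<gamma>] by auto
  moreover have "s \<gamma> \<notin> ?B" "- s \<gamma> \<notin> ?B" using insert.hyps by auto
  ultimately show ?case using insert by (simp add: mult.assoc)
qed

text \<open>Pairing the factors over a fibre gives \<open>q z - \<gamma>\<close>, which reduces the
  product to level \<open>k\<close> evaluated at \<open>q z\<close>.\<close>

lemma prod_R:
  assumes "sep k"
  shows "(\<Prod>\<beta>\<in>R k. z - \<beta>) = (q ^^ k) z"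
  using assms
proof (induction k arbitrary: z)
  case 0
  then show ?case by (simp add: R_0)
next
  case (Suc k)
  have R: "R (Suc k) = {\<beta>. q \<beta> \<in> R k}" using R_Suc by blast
  have "(z - s \<gamma>) * (z - - s \<gamma>) = q z - \<gamma>" for \<gamma>
  proof -
    have "(z - s \<gamma>) * (z - - s \<gamma>) = z\<^sup>2 - (s \<gamma>)\<^sup>2" by (simp add: algebra_simps power2_eq_square)
    then show ?thesis by (simp add: s_square q_def)
  qed
  then have "(\<Prod>\<beta>\<in>R (Suc k). z - \<beta>) = (\<Prod>\<gamma>\<in>R k. q z - \<gamma>)"
    unfolding R using Suc.prems finite_R by (subst prod_fibres) (auto simp: sep_def)
  also have "\<dots> = (q ^^ k) (q z)" using Suc.IH Suc.prems sep_mono[of "Suc k" k] by simp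
  finally show ?case by (simp add: funpow_Suc_right del: funpow.simps)
qed

lemma prod_s_square: "(prod s J)\<^sup>2 = (\<Prod>\<gamma>\<in>J. \<gamma> - C)"
  by (simp add: prod_power_distrib s_square)

lemma hom_iterate:
  assumes h: "field_hom (K k) \<sigma>" and "z \<in> K k"
  shows "\<sigma> ((q ^^ j) z) = (q ^^ j) (\<sigma> z)" "(q ^^ j) z \<in> K k"
proof -
  have "\<sigma> ((q ^^ j) z) = (q ^^ j) (\<sigma> z) \<and> (q ^^ j) z \<in> K k"
    by (induction j) (use hom_q[OF h] q_in_K \<open>z \<in> K k\<close> in auto)
  then show "\<sigma> ((q ^^ j) z) = (q ^^ j) (\<sigma> z)" "(q ^^ j) z \<in> K k" by auto
qed

text \<open>The dependency is pushed down the tree: \<open>P j\<close> says that a nonempty product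
  of values of \<open>e j\<close> on level \<open>j\<close> is a square in \<open>K m\<close>. At
  level 0 the only vertex is 0, and the product is \<open>a (Suc m)\<close>.\<close>

lemma square_if_not_indep:
  assumes ind: "\<And>i. i < m \<Longrightarrow> indep i" and "sep (Suc m)" and "\<not> indep m" and "m > 0"
  shows "\<exists>x\<in>K m. x\<^sup>2 = of_int (a (Suc m))"
proof -
  \<comment> \<open>Up to sign, \<open>e j \<beta>\<close> is the product of \<open>\<gamma> - C\<close> over all \<open>\<gamma> \<in> R m\<close> above \<open>\<beta>\<close>.\<close>
  define e where "e j \<beta> = (if j = m then \<beta> - C else (q ^^ (m - j)) C - \<beta>)" for j \<beta>
  have CR: "C \<notin> R j" if "j \<le> m" for j using assms(2) that by (auto simp: sep_def)
  have RK: "R j \<subseteq> K m" if "j \<le> m" for j using R_subset_K K_mono[OF that] by blast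
  have e_nz: "e j \<beta> \<noteq> 0" if "j \<le> m" "\<beta> \<in> R j" for j \<beta>
  proof (cases "j = m")
    case True
    then show ?thesis using CR[of m] that by (auto simp: e_def)
  next
    case False
    \<comment> \<open>The \<open>j\<close>-th iterate kills \<open>\<beta>\<close> but sends
      \<open>(q ^^ (m - j)) C\<close> to \<open>(q ^^ m) C\<close>, which is nonzero by
      \<open>C \<notin> R m\<close>; so the two differ.\<close>
    have "(q ^^ j) ((q ^^ (m - j)) C) \<noteq> 0"
      using CR[of m] that(1) funpow_add[of j "m - j" q] by (simp add: R_def)
    then show ?thesis using False that(2) by (auto simp: e_def R_def)
  qed
  have e_hom: "\<tau> (e j \<beta>) = e j (\<tau> \<beta>)" if "field_hom (K m) \<tau>" "j \<le> m" "\<beta> \<in> R j" for \<tau> j \<beta>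
    using that RK[of j] C_in_K[of m] hom_iterate[OF that(1) C_in_K]
    by (auto simp: e_def field_homD(8)[OF that(1)] field_hom_of_int[OF that(1)])
  have e_K: "e j \<beta> \<in> K m" if "j \<le> m" "\<beta> \<in> R j" for j \<beta>
    using that RK[of j] C_in_K[of m] hom_iterate(2)[OF field_hom_id[OF K_subfield] C_in_K]
    by (auto simp: e_def intro!: KD(7))
  have e_norm: "e (Suc j) (s \<gamma>) * e (Suc j) (- s \<gamma>) = e j \<gamma>" if "j < m" for j \<gamma>
  proof (cases "Suc j = m")
    case True
    \<comment> \<open>At the top level the factors are \<open>\<beta> - C\<close> rather than
      \<open>C - \<beta>\<close>; the two signs cancel in the pair.\<close>
    have "(s \<gamma> - C) * (- s \<gamma> - C) = C\<^sup>2 - (s \<gamma>)\<^sup>2" by (simp add: algebra_simps power2_eq_square)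
    also have "\<dots> = q C - \<gamma>" by (simp add: s_square q_def)
    finally show ?thesis using True by (auto simp: e_def)
  next
    case False
    let ?w = "(q ^^ (m - Suc j)) C"
    have "(?w - s \<gamma>) * (?w - - s \<gamma>) = ?w\<^sup>2 - (s \<gamma>)\<^sup>2" by (simp add: algebra_simps power2_eq_square)
    also have "\<dots> = q ?w - \<gamma>" by (simp add: s_square q_def)
    also have "q ?w = (q ^^ Suc (m - Suc j)) C" by simp
    also have "Suc (m - Suc j) = m - j" using that by simp
    finally show ?thesis using False that by (simp add: e_def)
  qed
  define P where "P j \<longleftrightarrow> (\<exists>J x. J \<subseteq> R j \<and> J \<noteq> {} \<and> x \<in> K m \<and> x\<^sup>2 = prod (e j) J)" for j
  have "P m"
  proof -
    obtain J where "J \<subseteq> R m" "J \<noteq> {}" "prod s J \<in> K m"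
      using assms(3) by (auto simp: indep_def)
    moreover have "(prod s J)\<^sup>2 = prod (e m) J" using prod_s_square[of J] by (simp add: e_def)
    ultimately show ?thesis unfolding P_def by (intro exI conjI)
  qed
  have step: "P j" if step: "P (Suc j)" and "j < m" for j
  proof -
    obtain J x where J: "J \<subseteq> R (Suc j)" "J \<noteq> {}" and x: "x \<in> K m" "x\<^sup>2 = prod (e (Suc j)) J"
      using step unfolding P_def by blast
    have finJ: "finite J" using J(1) finite_R finite_subset by blast
    show ?thesis
      \<comment> \<open>Either \<open>J\<close> is a union of fibres of \<open>q\<close>, or multiplying \<open>x\<close> by its image under a flip at some
        \<open>\<alpha>\<close> isolates the fibre of \<open>\<alpha>\<close>.\<close>
    proof (cases "\<forall>\<alpha>\<in>J. - \<alpha> \<in> J")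
      case True
      have "{\<beta>. q \<beta> \<in> q ` J} = J" using True by (auto simp: q_eq_iff)
      moreover have "q ` J \<subseteq> R j" using J(1) R_Suc by auto
      ultimately have "prod (e (Suc j)) J = prod (e j) (q ` J)"
        using prod_fibres[of "q ` J" "e (Suc j)"] finJ CR[of j] \<open>j < m\<close> e_norm by auto
      then show ?thesis unfolding P_def using x J \<open>q ` J \<subseteq> R j\<close>
        by (intro exI[of _ "q ` J"] exI[of _ x]) auto
    next
      case False
      then obtain \<alpha> where \<alpha>: "\<alpha> \<in> J" "- \<alpha> \<notin> J" by blast
      then have \<alpha>R: "\<alpha> \<in> R (Suc j)" using J by blast
      obtain \<tau> where \<tau>: "field_hom (K m) \<tau>" "\<tau> \<alpha> = - \<alpha>"
        "\<And>\<beta>. \<beta> \<in> R (Suc j) \<Longrightarrow> q \<beta> \<noteq> q \<alpha> \<Longrightarrow> \<tau> \<beta> = \<beta>"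
        using hom_flip[OF ind \<open>j < m\<close> \<alpha>R] by metis
      let ?E = "e (Suc j)" and ?J = "J - {\<alpha>}"
      have JE: "prod ?E J = ?E \<alpha> * prod ?E ?J" using finJ \<alpha> by (simp add: prod.remove)
      have "(\<tau> x)\<^sup>2 = \<tau> (prod ?E J)" using x field_homD(9)[OF \<tau>(1) x(1), of 2] by simp
      also have "\<dots> = (\<Prod>\<beta>\<in>J. ?E (\<tau> \<beta>))"
        using field_hom_prod[OF \<tau>(1), of J ?E] e_K e_hom[OF \<tau>(1)] J(1) \<open>j < m\<close>
        by (smt (verit) Suc_leI prod.cong subsetD)
      also have "\<dots> = ?E (- \<alpha>) * (\<Prod>\<beta>\<in>?J. ?E (\<tau> \<beta>))"
        using finJ \<alpha> \<tau>(2) by (simp add: prod.remove)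
      also have "(\<Prod>\<beta>\<in>?J. ?E (\<tau> \<beta>)) = prod ?E ?J"
      proof (rule prod.cong[OF refl])
        fix \<beta> assume "\<beta> \<in> ?J"
        then have "\<beta> \<in> R (Suc j)" "q \<beta> \<noteq> q \<alpha>" using J \<alpha> by (auto simp: q_eq_iff)
        then show "?E (\<tau> \<beta>) = ?E \<beta>" using \<tau>(3) by simp
      qed
      finally have \<tau>x: "(\<tau> x)\<^sup>2 = ?E (- \<alpha>) * prod ?E ?J" .
      have "?E \<alpha> * ?E (- \<alpha>) = e j (q \<alpha>)"
        using e_norm[OF \<open>j < m\<close>, of "q \<alpha>"] q_fibre[of \<alpha> "q \<alpha>"] by (metis minus_minus mult.commute)
      then have "(x * \<tau> x)\<^sup>2 = e j (q \<alpha>) * (prod ?E ?J)\<^sup>2"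
        unfolding power_mult_distrib x(2) JE \<tau>x by (simp add: power2_eq_square ac_simps)
      moreover have "prod ?E ?J \<noteq> 0" using e_nz J(1) finJ \<open>j < m\<close> by (auto simp: prod_zero_iff)
      ultimately have "(x * \<tau> x / prod ?E ?J)\<^sup>2 = e j (q \<alpha>)" by (simp add: power_divide)
      moreover have "x * \<tau> x / prod ?E ?J \<in> K m"
        using x(1) hom_K[OF \<tau>(1)] J(1) \<open>j < m\<close> e_K
        by (intro KD(8) KD(6) is_subfield_prod[OF K_subfield]) auto
      ultimately show ?thesis unfolding P_def using \<alpha>R R_Suc
        by (intro exI[of _ "{q \<alpha>}"] exI[of _ "x * \<tau> x / prod ?E ?J"]) auto
    qed
  qed
  have "P 0"
    by (rule inc_induct[of 0 m P]) (use \<open>P m\<close> step in auto)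
  \<comment> \<open>The only nonempty subset of \<open>R 0\<close> is \<open>{0}\<close>. As
    \<open>m > 0\<close>, the value \<open>e 0 0\<close> comes from the second branch of
    \<open>e\<close> and is \<open>(q ^^ m) C\<close>.\<close>
  then obtain x where "x \<in> K m" "x\<^sup>2 = e 0 0"
    unfolding P_def R_0 subset_singleton_iff by auto
  then show ?thesis using \<open>m > 0\<close> iterate_C[of m] by (auto simp: e_def)
qed

text \<open>By Kummer theory \<open>x\<close> is, up to \<open>K k\<close>, a product of roots over
  some \<open>J\<close>. If \<open>J\<close> is neither empty nor all of \<open>R k\<close>,
  transitivity moves it to another set, and comparison with the conjugate violates independence. The
  full set contributes the norm, which is \<open>a (Suc k)\<close> up to sign.\<close>

lemma square_descend:
  assumes ind: "\<And>i. i \<le> k \<Longrightarrow> indep i" and "sep (Suc k)"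
    and x: "x \<in> K (Suc k)" "x\<^sup>2 = of_int N"
  shows "\<exists>y\<in>K k. \<exists>\<epsilon>\<in>{1, a (Suc k), - a (Suc k)}. y\<^sup>2 = of_int (N * \<epsilon>)"
proof (cases "x = 0")
  case True
  then show ?thesis using x KD(1) by (intro bexI[of _ 0] bexI[of _ 1]) auto
next
  case False
  have CR: "C \<notin> R k" using assms(2) by (simp add: sep_def)
  obtain J where J: "J \<subseteq> R k" "x * prod s J \<in> K k"
    using kummer_quadratic[OF K_subfield finite_R[of k] s_square_in_K x(1)[unfolded K_Suc_eq]]
      x(2) is_subfield_of_int[OF K_subfield] by auto
  define y where "y = x * prod s J"
  have y: "y \<in> K k" "y\<^sup>2 = of_int N * (\<Prod>\<gamma>\<in>J. \<gamma> - C)"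
    using J by (auto simp: y_def power_mult_distrib x prod_s_square)
  consider "J = {}" | "J = R k" | \<alpha> \<beta> where "\<alpha> \<in> J" "\<beta> \<in> R k" "\<beta> \<notin> J" using J(1) by blast
  then show ?thesis
  proof cases
    case 1
    then show ?thesis using y by (intro bexI[of _ y] bexI[of _ 1]) auto
  next
    case 2
    \<comment> \<open>Turning the factors into \<open>C - \<gamma>\<close> costs one sign per root,
      and \<open>prod_R\<close> at \<open>C\<close> then gives \<open>(q ^^ k) C\<close>.\<close>
    have "(\<Prod>\<gamma>\<in>R k. \<gamma> - C) = (-1) ^ card (R k) * (\<Prod>\<gamma>\<in>R k. C - \<gamma>)"
      by (simp add: prod.distrib[symmetric] flip: prod_constant)
    also have "\<dots> = (-1) ^ card (R k) * of_int (a (Suc k))"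
      using prod_R[of k C] sep_mono[OF assms(2), of k] by (simp add: iterate_C)
    finally have "y\<^sup>2 = of_int (N * ((-1) ^ card (R k) * a (Suc k)))" using y(2) 2 by simp
    moreover have "(-1) ^ card (R k) * a (Suc k) \<in> {1, a (Suc k), - a (Suc k)}"
      by (cases "even (card (R k))") auto
    ultimately show ?thesis using y(1) by blast
  next
    case 3
    obtain g where g: "field_hom (K k) g" "g \<alpha> = \<beta>"
      using hom_transitive[of k \<alpha> \<beta>] ind 3 J(1) by auto
    let ?f = "\<lambda>\<gamma>. \<gamma> - C" and ?D = "(J - g ` J) \<union> (g ` J - J)"
    have finJ: "finite J" using J(1) finite_R finite_subset by blast
    have gJ: "g ` J \<subseteq> R k" using hom_R_image[OF g(1)] J(1) by blast
    have JK: "J \<subseteq> K k" using J(1) R_subset_K by blast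
    have "(g y)\<^sup>2 = g (of_int N * prod ?f J)"
      using field_homD(9)[OF g(1) y(1), of 2] y(2) by simp
    also have "\<dots> = of_int N * g (prod ?f J)"
      using JK C_in_K by (subst field_homD(5)[OF g(1)])
        (auto simp: field_hom_of_int[OF g(1)] intro!: is_subfield_of_int[OF K_subfield] is_subfield_prod[OF K_subfield] KD(7))
    also have "g (prod ?f J) = (\<Prod>\<gamma>\<in>J. ?f (g \<gamma>))"
    proof -
      have "g (prod ?f J) = (\<Prod>\<gamma>\<in>J. g (?f \<gamma>))"
        using JK C_in_K by (intro field_hom_prod[OF g(1)] KD(7)) auto
      also have "\<dots> = (\<Prod>\<gamma>\<in>J. ?f (g \<gamma>))"
        using JK by (intro prod.cong refl) (simp add: field_homD(8)[OF g(1) _ C_in_K] field_hom_of_int[OF g(1)] subset_iff)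
      finally show ?thesis .
    qed
    also have "\<dots> = prod ?f (g ` J)"
      using inj_on_subset[OF field_hom_inj[OF g(1)] JK] by (simp add: prod.reindex)
    \<comment> \<open>Modulo squares the two products combine into one over \<open>?D\<close>.
      Taking square roots, up to sign, expresses \<open>prod s ?D\<close> by elements of
      \<open>K k\<close>.\<close>
    finally have "(y * g y)\<^sup>2 = (of_int N)\<^sup>2 * (prod ?f J * prod ?f (g ` J))"
      unfolding power_mult_distrib y(2) by (simp add: power2_eq_square ac_simps)
    also have "\<dots> = (of_int N * prod ?f (J \<inter> g ` J) * prod s ?D)\<^sup>2"
      by (simp add: prod_mult_prod_sym_diff finJ power_mult_distrib prod_s_square)
    finally have "y * g y = of_int N * prod ?f (J \<inter> g ` J) * prod s ?D \<or>
      y * g y = - (of_int N * prod ?f (J \<inter> g ` J) * prod s ?D)" by (simp add: power2_eq_iff)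
    moreover have "N \<noteq> 0" using False x(2) by auto
    moreover have "prod ?f (J \<inter> g ` J) \<noteq> 0" using CR J(1) finJ by (auto simp: prod_zero_iff)
    ultimately have "prod s ?D = y * g y / (of_int N * prod ?f (J \<inter> g ` J)) \<or>
      prod s ?D = - (y * g y / (of_int N * prod ?f (J \<inter> g ` J)))" by (auto simp: field_simps)
    moreover have "y * g y / (of_int N * prod ?f (J \<inter> g ` J)) \<in> K k"
      using y(1) hom_K[OF g(1)] JK C_in_K
      by (intro KD(6-8) is_subfield_prod[OF K_subfield] is_subfield_of_int[OF K_subfield]) auto
    ultimately have "prod s ?D \<in> K k" using KD(3) by metis
    moreover have "?D \<subseteq> R k" "?D \<noteq> {}" using gJ J(1) 3 g(2) by auto
    ultimately show ?thesis using ind[of k] by (auto simp: indep_def)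
  qed
qed

text \<open>Descend to the rationals with \<open>square_descend\<close>; \<open>u\<close> collects
  the factors \<open>\<epsilon>\<close> picked up on the way, all of them coprime to
  \<open>F\<close>. At the bottom \<open>F * u\<close> is an integer square with coprime
  factors.\<close>

lemma int_square_if_square_in_K:
  assumes "\<And>i. i < m \<Longrightarrow> indep i" and "sep m" and "\<And>k. k \<in> {1..m} \<Longrightarrow> coprime F (a k)"
    and "x \<in> K m" "x\<^sup>2 = of_int (F * u)" "coprime F u"
  shows "\<exists>y. y\<^sup>2 = F \<or> - (y\<^sup>2) = F"
  using assms
proof (induction m arbitrary: x u)
  case 0
  then show ?case
    using int_square_if_Rats_square[of x "F * u"] square_if_coprime_mult_square by (auto simp: K_0)
next
  case (Suc m)
  have "\<exists>y\<in>K m. \<exists>\<epsilon>\<in>{1, a (Suc m), - a (Suc m)}. y\<^sup>2 = of_int (F * u * \<epsilon>)"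
    using Suc.prems(1,2,4,5) by (intro square_descend) auto
  then obtain y \<epsilon> where
    y: "y \<in> K m" "\<epsilon> \<in> {1, a (Suc m), - a (Suc m)}" "y\<^sup>2 = of_int (F * u * \<epsilon>)" by blast
  have "coprime F (u * \<epsilon>)" using y(2) Suc.prems(3)[of "Suc m"] Suc.prems(6) by auto
  then show ?case
    using Suc.prems y sep_mono[of "Suc m" m] by (intro Suc.IH[of y "u * \<epsilon>"]) (auto simp: mult.assoc)
qed

lemma indep_step:
  assumes "\<And>i. i < m \<Longrightarrow> indep i" and "sep (Suc m)" "m > 0"
    and "\<And>k. k \<in> {1..m} \<Longrightarrow> coprime F (a k)" "a (Suc m) = F * u" "coprime F u"
    and "\<nexists>y. y\<^sup>2 = F" "\<nexists>y. - (y\<^sup>2) = F"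
  shows "indep m"
proof (rule ccontr)
  assume "\<not> indep m"
  then obtain x where "x \<in> K m" "x\<^sup>2 = of_int (F * u)"
    using square_if_not_indep[of m] assms by auto
  then show False
    using int_square_if_square_in_K[of m F x u] assms sep_mono[of "Suc m" m] by auto
qed

end

section \<open>Galois group and tree automorphisms\<close>

lemma map_poly_of_rat_add:
  "map_poly of_rat (f + g) = (map_poly of_rat f + map_poly of_rat g :: 'a::field_char_0 poly)"
  by (intro poly_eqI) (simp add: coeff_map_poly of_rat_add)

lemma map_poly_of_rat_mult:
  "map_poly of_rat (f * g) = (map_poly of_rat f * map_poly of_rat g :: 'a::field_char_0 poly)"
  by (intro poly_eqI) (simp add: coeff_map_poly coeff_mult of_rat_sum of_rat_mult)

lemma poly_iterate_quad_Suc: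
  "poly_iterate (quad d) (Suc n) = [:d:] + poly_iterate (quad d) n * poly_iterate (quad d) n"
  by (simp add: poly_iterate_def quad_def pcompose_pCons)

lemma complex_ring_simps:
  "carrier complex_ring = UNIV" "\<one>\<^bsub>complex_ring\<^esub> = 1" "\<zero>\<^bsub>complex_ring\<^esub> = 0"
  "x \<otimes>\<^bsub>complex_ring\<^esub> y = x * y" "x \<oplus>\<^bsub>complex_ring\<^esub> y = x + y"
  by (simp_all add: ring_of_type_algebra_def)

lemma complex_ring_a_inv: "\<ominus>\<^bsub>complex_ring\<^esub> x = - x"
proof -
  interpret field complex_ring by (rule field_from_type_algebra)
  show ?thesis by (rule minus_equality) (simp_all add: complex_ring_simps)
qed

lemma complex_ring_m_inv: "x \<noteq> 0 \<Longrightarrow> inv\<^bsub>complex_ring\<^esub> x = inverse x"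
proof -
  assume "x \<noteq> 0"
  interpret field complex_ring by (rule field_from_type_algebra)
  show ?thesis by (rule comm_inv_char) (use \<open>x \<noteq> 0\<close> in \<open>simp_all add: complex_ring_simps\<close>)
qed

lemma generate_field_complex_ring: "generate_field complex_ring H = is_subfield hull H"
proof
  show "generate_field complex_ring H \<subseteq> is_subfield hull H"
  proof
    fix x assume "x \<in> generate_field complex_ring H"
    then show "x \<in> is_subfield hull H"
      by (induction rule: generate_field.induct)
        (auto simp: complex_ring_simps complex_ring_a_inv complex_ring_m_inv
          is_subfieldD[OF is_subfield_hull] hull_inc)
  qed
  let ?G = "generate_field complex_ring H"
  \<comment> \<open>\<open>generate_field.m_inv\<close> covers nonzero elements; closure under
    \<open>inverse 0 = 0\<close> comes from this.\<close>
  have zero: "0 \<in> ?G"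
    using field.zero_in_generate[OF field_from_type_algebra, of H] by (simp add: complex_ring_simps)
  have "is_subfield ?G"
  proof (rule is_subfieldI)
    show "0 \<in> ?G" by fact
    show "1 \<in> ?G" using generate_field.one[of complex_ring H] by (simp add: complex_ring_simps)
    show "- x \<in> ?G" if "x \<in> ?G" for x
      using generate_field.a_inv[OF that] by (simp add: complex_ring_a_inv)
    show "inverse x \<in> ?G" if "x \<in> ?G" for x
      using generate_field.m_inv[OF that] zero
      by (cases "x = 0") (simp_all add: complex_ring_simps complex_ring_m_inv)
    show "x + y \<in> ?G" "x * y \<in> ?G" if "x \<in> ?G" "y \<in> ?G" for x y
      using generate_field.eng_add[OF that] generate_field.eng_mult[OF that]
      by (simp_all add: complex_ring_simps)
  qed
  then show "is_subfield hull H \<subseteq> ?G"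
    by (intro hull_minimal) (auto intro: generate_field.incl)
qed

context quadratic_tree
begin

abbreviation \<phi> :: "rat poly"
  where "\<phi> \<equiv> quad (of_int c)"

lemma complex_roots_iterate: "complex_roots (poly_iterate \<phi> k) = R k"
proof -
  have "poly (map_poly of_rat (poly_iterate \<phi> k)) z = (q ^^ k) z" for z
  proof (induction k)
    case 0
    then show ?case by (simp add: poly_iterate_def map_poly_pCons)
  next
    case (Suc k)
    then show ?case
      by (simp add: poly_iterate_quad_Suc map_poly_of_rat_add map_poly_of_rat_mult map_poly_pCons
          q_def power2_eq_square)
  qed
  then show ?thesis by (simp add: complex_roots_def R_def)
qed

lemma splitting_field_iterate: "splitting_field (poly_iterate \<phi> k) = K k"
proof -
  have "is_subfield hull (\<rat> \<union> R k) = K k"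
    unfolding K_def
    by (rule hull_unique)
      (use is_subfield_Rats[OF is_subfield_hull] in \<open>auto simp: is_subfield_hull intro: hull_inc hull_minimal[THEN subsetD]\<close>)
  then show ?thesis
    by (simp add: splitting_field_def complex_roots_iterate generate_field_complex_ring)
qed

text \<open>A homomorphism on \<open>K n\<close> fixes the rationals and is injective. It permutes
  \<open>R n\<close>, so its image is a subfield containing the generators of \<open>K n\<close>,
  whence surjectivity.\<close>

lemma carrier_galois:
  "\<sigma> \<in> carrier (arboreal_galois_group \<phi> n) \<longleftrightarrow> \<sigma> \<in> extensional (K n) \<and> field_hom (K n) \<sigma>"
  (is "?L \<longleftrightarrow> ?R")
proof
  have unf: "?L \<longleftrightarrow> \<sigma> \<in> Bij (K n) \<and>
       \<sigma> \<in> ring_hom (complex_ring\<lparr>carrier := K n\<rparr>) (complex_ring\<lparr>carrier := K n\<rparr>) \<and>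
       (\<forall>q \<in> \<rat> \<inter> K n. \<sigma> q = q)"
    by (simp add: arboreal_galois_group_def galois_group_def splitting_field_iterate)
  show ?R if ?L
    using that[unfolded unf] K_subfield
    by (auto simp: Bij_def ring_hom_def complex_ring_simps field_hom_def)
  show ?L if ?R
  proof -
    have h: "field_hom (K n) \<sigma>" and ext: "\<sigma> \<in> extensional (K n)" using that by auto
    have "is_subfield (\<sigma> ` K n)"
    proof (rule is_subfieldI)
      show "0 \<in> \<sigma> ` K n" "1 \<in> \<sigma> ` K n"
        using field_homD(2,3)[OF h] KD(1,2) by (metis image_eqI)+
      show "- x \<in> \<sigma> ` K n" "inverse x \<in> \<sigma> ` K n" if "x \<in> \<sigma> ` K n" for x
      proof -
        obtain x' where x': "x' \<in> K n" "x = \<sigma> x'" using \<open>x \<in> \<sigma> ` K n\<close> by blast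
        show "- x \<in> \<sigma> ` K n" "inverse x \<in> \<sigma> ` K n"
          unfolding x'(2) field_homD(6,7)[OF h x'(1), symmetric] by (intro imageI KD(3,4) x'(1))+
      qed
      show "x + y \<in> \<sigma> ` K n" "x * y \<in> \<sigma> ` K n" if "x \<in> \<sigma> ` K n" "y \<in> \<sigma> ` K n" for x y
      proof -
        obtain x' y' where x': "x' \<in> K n" "x = \<sigma> x'" and y': "y' \<in> K n" "y = \<sigma> y'"
          using \<open>x \<in> \<sigma> ` K n\<close> \<open>y \<in> \<sigma> ` K n\<close> by blast
        show "x + y \<in> \<sigma> ` K n" "x * y \<in> \<sigma> ` K n"
          unfolding x'(2) y'(2) field_homD(4,5)[OF h x'(1) y'(1), symmetric]
          by (intro imageI KD(5,6) x'(1) y'(1))+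
      qed
    qed
    moreover have "R n \<subseteq> \<sigma> ` K n" using hom_R_image[OF h] R_subset_K[of n] by blast
    ultimately have "K n \<subseteq> \<sigma> ` K n" unfolding K_def[of n] by (intro hull_minimal)
    then have "bij_betw \<sigma> (K n) (K n)"
      using hom_K[OF h] field_hom_inj[OF h] by (auto simp: bij_betw_def)
    then show ?thesis
      unfolding unf using ext hom_K[OF h] field_hom_Rats[OF h]
      by (auto simp: Bij_def ring_hom_def complex_ring_simps field_homD[OF h])
  qed
qed

section \<open>Tree automorphisms described level by level\<close>

definition level_map :: "nat \<Rightarrow> (nat \<Rightarrow> complex \<Rightarrow> complex) \<Rightarrow> bool"
  where "level_map n f \<longleftrightarrow>
    (\<forall>j\<le>n. f j ` R j \<subseteq> R j \<and> inj_on (f j) (R j)) \<and>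
    (\<forall>j<n. \<forall>\<beta>\<in>R (Suc j). q (f (Suc j) \<beta>) = f j (q \<beta>))"

definition tree_map :: "nat \<Rightarrow> (nat \<Rightarrow> complex \<Rightarrow> complex) \<Rightarrow> nat \<times> complex \<Rightarrow> nat \<times> complex"
  where "tree_map n f = (\<lambda>(j, \<beta>) \<in> tree_verts \<phi> n. (j, f j \<beta>))"

lemma in_tree_verts: "(j, \<beta>) \<in> tree_verts \<phi> n \<longleftrightarrow> j \<le> n \<and> \<beta> \<in> R j"
  by (simp add: tree_verts_def complex_roots_iterate)

lemma in_tree_edges:
  "((i, \<alpha>), (j, \<beta>)) \<in> tree_edges \<phi> n \<longleftrightarrow> i = Suc j \<and> j < n \<and> \<alpha> \<in> R i \<and> \<beta> = q \<alpha>"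
proof -
  have "poly (map_poly of_rat \<phi>) z = q z" for z
    by (simp add: quad_def map_poly_pCons q_def power2_eq_square)
  then show ?thesis by (auto simp: tree_edges_def in_tree_verts)
qed

lemma carrier_tree_aut:
  "\<pi> \<in> carrier (tree_aut_group \<phi> n) \<longleftrightarrow> \<pi> \<in> Bij (tree_verts \<phi> n) \<and> \<pi> (0, 0) = (0, 0) \<and>
    (\<forall>u \<in> tree_verts \<phi> n. \<forall>v \<in> tree_verts \<phi> n.
      (\<pi> u, \<pi> v) \<in> tree_edges \<phi> n \<longleftrightarrow> (u, v) \<in> tree_edges \<phi> n)"
  by (simp add: tree_aut_group_def)

lemma tree_map_apply: "j \<le> n \<Longrightarrow> \<beta> \<in> R j \<Longrightarrow> tree_map n f (j, \<beta>) = (j, f j \<beta>)"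
  by (simp add: tree_map_def in_tree_verts)

text \<open>Injectivity on each level gives bijectivity because the tree is finite; commuting with
  \<open>q\<close>, together with injectivity, preserves edges in both directions.\<close>

lemma tree_map_in_carrier:
  assumes "level_map n f"
  shows "tree_map n f \<in> carrier (tree_aut_group \<phi> n)"
  unfolding carrier_tree_aut
proof (intro conjI ballI)
  have f: "f j \<beta> \<in> R j" "\<beta> \<in> R j \<Longrightarrow> \<beta>' \<in> R j \<Longrightarrow> f j \<beta> = f j \<beta>' \<longleftrightarrow> \<beta> = \<beta>'"
    if "j \<le> n" "\<beta> \<in> R j" for j \<beta> \<beta>'
    using assms that by (auto simp: level_map_def inj_on_def)
  let ?V = "tree_verts \<phi> n"
  have "finite ?V" unfolding tree_verts_def by (auto simp: complex_roots_iterate finite_R)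
  moreover have "tree_map n f ` ?V \<subseteq> ?V"
    by (auto simp: in_tree_verts tree_map_apply f)
  moreover have "inj_on (tree_map n f) ?V"
    by (rule inj_onI) (auto simp: in_tree_verts tree_map_apply f)
  ultimately have "bij_betw (tree_map n f) ?V ?V"
    by (simp add: bij_betw_def endo_inj_surj)
  then show "tree_map n f \<in> Bij ?V" by (simp add: Bij_def tree_map_def)
  show "tree_map n f (0, 0) = (0, 0)"
    using f(1)[of 0 0] by (simp add: tree_map_apply R_0)
  fix u v assume "u \<in> ?V" "v \<in> ?V"
  then obtain i \<alpha> j \<beta> where uv: "u = (i, \<alpha>)" "v = (j, \<beta>)" "i \<le> n" "\<alpha> \<in> R i" "j \<le> n" "\<beta> \<in> R j"
    using in_tree_verts by (metis prod.exhaust)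
  have "f j \<beta> = q (f i \<alpha>) \<longleftrightarrow> \<beta> = q \<alpha>" if "i = Suc j" "j < n"
  proof -
    have "q (f i \<alpha>) = f j (q \<alpha>)" using assms that uv by (auto simp: level_map_def)
    moreover have "q \<alpha> \<in> R j" using uv that R_Suc by blast
    ultimately show ?thesis using f(2) uv by metis
  qed
  then show "(tree_map n f u, tree_map n f v) \<in> tree_edges \<phi> n \<longleftrightarrow> (u, v) \<in> tree_edges \<phi> n"
    using uv f(1) by (auto simp: tree_map_apply in_tree_edges)
qed

text \<open>Fixing the root and preserving edges forces an automorphism to preserve levels, by
  induction from the root.\<close>

lemma tree_map_surj:
  assumes "\<pi> \<in> carrier (tree_aut_group \<phi> n)"
  obtains f where "level_map n f" "\<pi> = tree_map n f"
proof
  define f where "f j \<beta> = snd (\<pi> (j, \<beta>))" for j \<beta>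
  let ?V = "tree_verts \<phi> n"
  have bij: "bij_betw \<pi> ?V ?V" and ext: "\<pi> \<in> extensional ?V" and zero: "\<pi> (0, 0) = (0, 0)"
    and edges: "\<And>u v. u \<in> ?V \<Longrightarrow> v \<in> ?V \<Longrightarrow>
      (\<pi> u, \<pi> v) \<in> tree_edges \<phi> n \<longleftrightarrow> (u, v) \<in> tree_edges \<phi> n"
    using assms by (auto simp: carrier_tree_aut Bij_def)
  have level: "\<pi> (j, \<beta>) = (j, f j \<beta>) \<and> (j > 0 \<longrightarrow> q (f j \<beta>) = f (j - 1) (q \<beta>))"
    if "j \<le> n" "\<beta> \<in> R j" for j \<beta>
    using that
  proof (induction j arbitrary: \<beta>)
    case 0
    then show ?case using zero by (simp add: R_0 f_def)
  next
    case (Suc j)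
    have q: "q \<beta> \<in> R j" using Suc.prems R_Suc by blast
    then have IH: "\<pi> (j, q \<beta>) = (j, f j (q \<beta>))" using Suc by simp
    have "((Suc j, \<beta>), (j, q \<beta>)) \<in> tree_edges \<phi> n" using Suc.prems by (simp add: in_tree_edges)
    then have "(\<pi> (Suc j, \<beta>), \<pi> (j, q \<beta>)) \<in> tree_edges \<phi> n"
      using edges Suc.prems q by (simp add: in_tree_verts)
    then show ?case
      unfolding IH by (cases "\<pi> (Suc j, \<beta>)") (simp add: in_tree_edges f_def)
  qed
  show "level_map n f"
    unfolding level_map_def
  proof (intro conjI allI impI ballI)
    fix j assume j: "j \<le> n"
    have *: "(j, f j \<beta>) \<in> ?V" if "\<beta> \<in> R j" for \<beta>
      using level[OF j that] bij_betwE[OF bij] in_tree_verts j that by metis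
    then show "f j ` R j \<subseteq> R j" by (auto simp: in_tree_verts)
    show "inj_on (f j) (R j)"
    proof (rule inj_onI)
      fix \<alpha> \<beta> assume "\<alpha> \<in> R j" "\<beta> \<in> R j" "f j \<alpha> = f j \<beta>"
      then have "\<pi> (j, \<alpha>) = \<pi> (j, \<beta>)" using level j by metis
      then show "\<alpha> = \<beta>"
        using inj_onD[OF bij_betw_imp_inj_on[OF bij], of "(j, \<alpha>)" "(j, \<beta>)"]
          \<open>\<alpha> \<in> R j\<close> \<open>\<beta> \<in> R j\<close> j by (simp add: in_tree_verts)
    qed
  next
    fix j \<beta> assume "j < n" "\<beta> \<in> R (Suc j)"
    then show "q (f (Suc j) \<beta>) = f j (q \<beta>)" using level[of "Suc j" \<beta>] by simp
  qed
  show "\<pi> = tree_map n f"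
  proof
    fix u
    show "\<pi> u = tree_map n f u"
    proof (cases "u \<in> ?V")
      case True
      then show ?thesis using level by (cases u) (simp add: in_tree_verts tree_map_apply)
    next
      case False
      then show ?thesis by (simp add: tree_map_def extensional_arb[OF ext])
    qed
  qed
qed

lemma tree_action_eq: "tree_action \<phi> n \<sigma> = tree_map n (\<lambda>_. \<sigma>)"
  by (simp add: tree_action_def tree_map_def)

lemma hom_level_map:
  assumes h: "field_hom (K n) \<sigma>"
  shows "level_map n (\<lambda>_. \<sigma>)"
proof -
  have RK: "R j \<subseteq> K n" if "j \<le> n" for j using R_subset_K K_mono[OF that] by blast
  show ?thesis
    unfolding level_map_def
  proof (intro conjI allI impI ballI)
    fix j assume "j \<le> n"
    then show "\<sigma> ` R j \<subseteq> R j" "inj_on \<sigma> (R j)"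
      using hom_R[OF h] RK inj_on_subset[OF field_hom_inj[OF h]] by blast+
  next
    fix j \<beta> assume "j < n" "\<beta> \<in> R (Suc j)"
    then show "q (\<sigma> \<beta>) = \<sigma> (q \<beta>)" using hom_q[OF h, of \<beta>] RK[of "Suc j"] by auto
  qed
qed

text \<open>Lift one level at a time with \<open>s \<gamma>\<close> sent to its prescribed image.
  The image of \<open>- s \<gamma>\<close> is then right automatically, both being the other point
  of the same fibre.\<close>

lemma level_map_hom:
  assumes "\<And>i. i < n \<Longrightarrow> indep i" "level_map n f"
  shows "\<exists>\<sigma>. field_hom (K n) \<sigma> \<and> (\<forall>j\<le>n. \<forall>\<beta>\<in>R j. \<sigma> \<beta> = f j \<beta>)"
  using assms
proof (induction n)
  case 0
  then have "f 0 0 = 0" by (simp add: level_map_def R_0)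
  then show ?case using field_hom_id[OF K_subfield] by (auto simp: R_0)
next
  case (Suc n)
  have "level_map n f" using Suc.prems(2) by (simp add: level_map_def)
  then obtain \<sigma> where \<sigma>: "field_hom (K n) \<sigma>" "\<And>j \<beta>. j \<le> n \<Longrightarrow> \<beta> \<in> R j \<Longrightarrow> \<sigma> \<beta> = f j \<beta>"
    using Suc.IH Suc.prems(1) by (metis less_SucI)
  have q: "q (f (Suc n) \<beta>) = f n (q \<beta>)" and inj: "inj_on (f (Suc n)) (R (Suc n))"
    if "\<beta> \<in> R (Suc n)" for \<beta>
    using Suc.prems(2) that by (auto simp: level_map_def)
  have sR: "s \<gamma> \<in> R (Suc n)" "- s \<gamma> \<in> R (Suc n)" if "\<gamma> \<in> R n" for \<gamma> using that by (simp_all add: R_Suc)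
  obtain \<tau> where \<tau>: "field_hom (K (Suc n)) \<tau>" "\<And>x. x \<in> K n \<Longrightarrow> \<tau> x = \<sigma> x"
    "\<And>\<gamma>. \<gamma> \<in> R n \<Longrightarrow> \<tau> (s \<gamma>) = f (Suc n) (s \<gamma>)"
  proof -
    have "q (f (Suc n) (s \<gamma>)) = \<sigma> \<gamma>" if "\<gamma> \<in> R n" for \<gamma>
      using that q[OF sR(1)] \<sigma>(2)[of n \<gamma>] by simp
    with that show ?thesis
      using hom_extend[OF Suc.prems(1)[of n] \<sigma>(1), of "\<lambda>\<gamma>. f (Suc n) (s \<gamma>)"] by auto
  qed
  have top: "\<tau> \<beta> = f (Suc n) \<beta>" if "\<beta> \<in> R (Suc n)" for \<beta>
  proof (cases "\<beta> = s (q \<beta>)")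
    case True
    then show ?thesis using \<tau>(3)[of "q \<beta>"] that by (simp add: R_Suc)
  next
    case False
    define \<gamma> where "\<gamma> = q \<beta>"
    have \<gamma>: "\<gamma> \<in> R n" "\<beta> = - s \<gamma>" using that False q_fibre[of \<beta> \<gamma>] by (auto simp: R_Suc \<gamma>_def)
    have "q (f (Suc n) \<beta>) = q (f (Suc n) (s \<gamma>))" using q that sR \<gamma> by simp
    moreover have "f (Suc n) \<beta> \<noteq> f (Suc n) (s \<gamma>)"
      using inj_onD[OF inj[OF that] _ that sR(1)[OF \<gamma>(1)]] False by (auto simp: \<gamma>_def)
    ultimately have "f (Suc n) \<beta> = - f (Suc n) (s \<gamma>)" by (simp add: q_eq_iff)
    then show ?thesis using \<tau>(3) \<gamma> field_homD(6)[OF \<tau>(1) s_in_K_Suc] by simp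
  qed
  have "\<tau> \<beta> = f j \<beta>" if "j \<le> Suc n" "\<beta> \<in> R j" for j \<beta>
  proof (cases "j = Suc n")
    case True
    then show ?thesis using top that by simp
  next
    case False
    then have j: "j \<le> n" using that by simp
    then have "\<beta> \<in> K n" using that R_subset_K K_mono[OF j] by blast
    then show ?thesis using \<tau>(2) \<sigma>(2)[OF j that(2)] by simp
  qed
  then show ?case using \<tau>(1) by blast
qed

section \<open>Full Galois image and independence\<close>

lemma full_arboreal_image_if_indep:
  assumes "\<And>i. i < n \<Longrightarrow> indep i" "sep n"
  shows "full_arboreal_image \<phi> n"
proof -
  let ?G = "arboreal_galois_group \<phi> n" and ?A = "tree_aut_group \<phi> n" and ?T = "tree_action \<phi> n"
  have RK: "R j \<subseteq> K n" if "j \<le> n" for j using R_subset_K K_mono[OF that] by blast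
  have T: "?T \<sigma> \<in> carrier ?A" if "\<sigma> \<in> carrier ?G" for \<sigma>
    using that by (simp add: carrier_galois tree_action_eq tree_map_in_carrier hom_level_map)
  have GB: "carrier ?G \<subseteq> Bij (K n)"
    by (auto simp: arboreal_galois_group_def galois_group_def splitting_field_iterate)
  have "?T (\<sigma> \<otimes>\<^bsub>?G\<^esub> \<tau>) = ?T \<sigma> \<otimes>\<^bsub>?A\<^esub> ?T \<tau>" if "\<sigma> \<in> carrier ?G" "\<tau> \<in> carrier ?G" for \<sigma> \<tau>
  proof -
    have "\<sigma> \<otimes>\<^bsub>?G\<^esub> \<tau> = compose (K n) \<sigma> \<tau>"
      using that GB
      by (auto simp: arboreal_galois_group_def galois_group_def splitting_field_iterate BijGroup_def)
    moreover have "?T \<sigma> \<otimes>\<^bsub>?A\<^esub> ?T \<tau> = compose (tree_verts \<phi> n) (?T \<sigma>) (?T \<tau>)"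
      using T that by (auto simp: carrier_tree_aut) (simp add: tree_aut_group_def BijGroup_def)
    moreover have "?T (compose (K n) \<sigma> \<tau>) u = compose (tree_verts \<phi> n) (?T \<sigma>) (?T \<tau>) u" for u
    proof (cases "u \<in> tree_verts \<phi> n")
      case True
      then obtain j \<beta> where u: "u = (j, \<beta>)" "j \<le> n" "\<beta> \<in> R j" by (cases u) (simp add: in_tree_verts)
      have "\<tau> \<beta> \<in> R j" using that(2) hom_R[of n \<tau>] u RK carrier_galois by blast
      then show ?thesis
        using True u RK[of j] by (auto simp: tree_action_eq tree_map_apply compose_def)
    next
      case False
      then show ?thesis by (simp add: tree_action_def compose_def)
    qed
    ultimately show ?thesis by presburger
  qed
  then have "?T \<in> hom ?G ?A" using T by (auto simp: hom_def)
  \<comment> \<open>The action on the top level already determines \<open>\<sigma>\<close>, since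
    \<open>R n\<close> generates \<open>K n\<close>.\<close>
  moreover have "inj_on ?T (carrier ?G)"
  proof (rule inj_onI)
    fix \<sigma> \<tau> assume st: "\<sigma> \<in> carrier ?G" "\<tau> \<in> carrier ?G" "?T \<sigma> = ?T \<tau>"
    have "\<sigma> \<beta> = \<tau> \<beta>" if "\<beta> \<in> R n" for \<beta>
      using fun_cong[OF st(3), of "(n, \<beta>)"] that by (simp add: tree_action_eq tree_map_apply)
    then have "\<sigma> x = \<tau> x" if "x \<in> K n" for x
      using st that field_hom_eq_hull[of "R n" \<sigma> \<tau> x] by (auto simp: carrier_galois K_def)
    then show "\<sigma> = \<tau>"
      using st by (intro extensionalityI[of \<sigma> "K n"]) (auto simp: carrier_galois)
  qed
  moreover have "carrier ?A \<subseteq> ?T ` carrier ?G"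
  proof
    fix \<pi> assume "\<pi> \<in> carrier ?A"
    then obtain f where f: "level_map n f" "\<pi> = tree_map n f" by (rule tree_map_surj)
    obtain \<sigma> where \<sigma>: "field_hom (K n) \<sigma>" "\<And>j \<beta>. j \<le> n \<Longrightarrow> \<beta> \<in> R j \<Longrightarrow> \<sigma> \<beta> = f j \<beta>"
      using level_map_hom[OF assms(1) f(1)] by blast
    \<comment> \<open>Group elements are undefined outside \<open>K n\<close>, hence the
      restriction.\<close>
    have "field_hom (K n) (restrict \<sigma> (K n))"
      using \<sigma>(1) KD by (auto simp: field_hom_def)
    then have "restrict \<sigma> (K n) \<in> carrier ?G" by (simp add: carrier_galois)
    moreover have "?T (restrict \<sigma> (K n)) = \<pi>"
      unfolding f(2) tree_action_def tree_map_def
      using \<sigma>(2) by (intro restrict_ext) (auto simp: in_tree_verts dest: subsetD[OF RK])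
    ultimately show "\<pi> \<in> ?T ` carrier ?G" by blast
  qed
  ultimately have "?T \<in> iso ?G ?A"
    using T by (auto simp: iso_def bij_betw_def)
  then show ?thesis
    unfolding full_arboreal_image_def complex_roots_iterate using card_R[OF assms(2)] by simp
qed

text \<open>Above level \<open>j + 1\<close>, where the swap takes place, the map is lifted along the section \<open>s\<close> of
  \<open>q\<close>.\<close>

primrec flip :: "nat \<Rightarrow> complex \<Rightarrow> nat \<Rightarrow> complex \<Rightarrow> complex"
  where "flip j \<alpha> 0 = (\<lambda>\<beta>. \<beta>)"
  | "flip j \<alpha> (Suc i) = (\<lambda>\<beta>. if i = j \<and> q \<beta> = \<alpha> then - \<beta>
      else if \<beta> = s (q \<beta>) then s (flip j \<alpha> i (q \<beta>)) else - s (flip j \<alpha> i (q \<beta>)))"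

text \<open>Below the swap the identity is lifted along \<open>s\<close>, which gives the identity
  again.\<close>

lemma flip_low: "i \<le> j \<Longrightarrow> flip j \<alpha> i \<beta> = \<beta>"
proof (induction i arbitrary: \<beta>)
  case (Suc i)
  then show ?case using q_fibre[of \<beta> "q \<beta>"] by auto
qed simp

lemma q_flip: "q (flip j \<alpha> (Suc i) \<beta>) = flip j \<alpha> i (q \<beta>)"
  using flip_low[of j j \<alpha> "q \<beta>"] by auto

lemma level_map_flip:
  assumes "sep n"
  shows "level_map n (flip j \<alpha>)"
  unfolding level_map_def
proof (intro conjI allI impI ballI)
  have R: "flip j \<alpha> i \<beta> \<in> R i" if "\<beta> \<in> R i" for i \<beta>
    using that by (induction i arbitrary: \<beta>) (simp_all only: flip.simps(1) R_Suc q_flip)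
  then show "flip j \<alpha> i ` R i \<subseteq> R i" for i by blast
  show "inj_on (flip j \<alpha> i) (R i)" if "i \<le> n" for i
    using that
  proof (induction i)
    case 0
    then show ?case by simp
  next
    case (Suc i)
    show ?case
    proof (rule inj_onI)
      fix \<beta> \<beta>' assume b: "\<beta> \<in> R (Suc i)" "\<beta>' \<in> R (Suc i)" "flip j \<alpha> (Suc i) \<beta> = flip j \<alpha> (Suc i) \<beta>'"
      then have "flip j \<alpha> i (q \<beta>) = flip j \<alpha> i (q \<beta>')" by (metis q_flip)
      moreover have "q \<beta> \<in> R i" "q \<beta>' \<in> R i" using b R_Suc by blast+
      ultimately have qq: "q \<beta> = q \<beta>'" using Suc by (auto simp: inj_on_def)
      \<comment> \<open>Hence the lifted root is nonzero and its two signs give different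
        points.\<close>
      have "C \<notin> R i" using Suc.prems assms by (auto simp: sep_def)
      then have "s (flip j \<alpha> i (q \<beta>)) \<noteq> 0" using R[OF \<open>q \<beta> \<in> R i\<close>] s_eq_0_iff by auto
      then show "\<beta> = \<beta>'"
        using b(3) qq q_fibre[of \<beta> "q \<beta>"] q_fibre[of \<beta>' "q \<beta>"] by (auto split: if_splits)
    qed
  qed
  show "q (flip j \<alpha> (Suc i) \<beta>) = flip j \<alpha> i (q \<beta>)" for i \<beta> by (rule q_flip)
qed

text \<open>A Galois element realising the flip at some \<open>\<alpha> \<in> J\<close> fixes
  \<open>K j\<close> pointwise but negates \<open>prod s J\<close>. A product in \<open>K j\<close>
  would thus be 0, contrary to separability.\<close>

lemma indep_if_full_arboreal_image:
  assumes full: "full_arboreal_image \<phi> n" and "j < n"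
  shows "indep j"
  unfolding indep_def
proof (intro allI impI notI)
  fix J assume J: "J \<subseteq> R j" "J \<noteq> {}" and prod: "prod s J \<in> K j"
  have finJ: "finite J" using J(1) finite_R finite_subset by blast
  have iso: "tree_action \<phi> n \<in> iso (arboreal_galois_group \<phi> n) (tree_aut_group \<phi> n)" and sep: "sep n"
    using full by (auto simp: full_arboreal_image_def complex_roots_iterate sep_if_card_R)
  obtain \<alpha> where \<alpha>: "\<alpha> \<in> J" using J by blast
  have "tree_map n (flip j \<alpha>) \<in> carrier (tree_aut_group \<phi> n)"
    by (rule tree_map_in_carrier[OF level_map_flip[OF sep]])
  then obtain \<sigma> where \<sigma>: "\<sigma> \<in> carrier (arboreal_galois_group \<phi> n)"
    "tree_action \<phi> n \<sigma> = tree_map n (flip j \<alpha>)"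
    using iso unfolding iso_def bij_betw_def by (smt (verit) image_iff mem_Collect_eq)
  have h: "field_hom (K n) \<sigma>" using \<sigma>(1) carrier_galois by blast
  have eq: "\<sigma> \<beta> = flip j \<alpha> i \<beta>" if "i \<le> n" "\<beta> \<in> R i" for i \<beta>
    using fun_cong[OF \<sigma>(2), of "(i, \<beta>)"] that by (simp add: tree_action_eq tree_map_apply)
  have hj: "field_hom (K j) \<sigma>"
    using field_hom_mono[OF h K_subfield] K_mono[of j n] \<open>j < n\<close> by simp
  have "\<sigma> (prod s J) = prod s J"
    using field_hom_eq_hull[of "R j" \<sigma> "\<lambda>x. x" "prod s J"] hj field_hom_id[OF K_subfield[of j]]
      prod eq[of j] flip_low[of j j \<alpha>] \<open>j < n\<close> by (simp add: K_def)
  moreover have "\<sigma> (prod s J) = - prod s J"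
  proof -
    have sK: "s \<gamma> \<in> K n" if "\<gamma> \<in> J" for \<gamma>
      using that J(1) s_in_K_Suc[of \<gamma> j] K_mono[of "Suc j" n] \<open>j < n\<close> by auto
    have s: "\<sigma> (s \<gamma>) = (if \<gamma> = \<alpha> then - s \<gamma> else s \<gamma>)" if "\<gamma> \<in> J" for \<gamma>
      using eq[of "Suc j" "s \<gamma>"] that J(1) \<open>j < n\<close> flip_low[of j j \<alpha> \<gamma>] by (auto simp: R_Suc)
    have "\<sigma> (prod s J) = (\<Prod>\<gamma>\<in>J. if \<gamma> = \<alpha> then - s \<gamma> else s \<gamma>)"
      using field_hom_prod[OF h, of J s] sK s by simp
    also have "\<dots> = - s \<alpha> * (\<Prod>\<gamma>\<in>J - {\<alpha>}. if \<gamma> = \<alpha> then - s \<gamma> else s \<gamma>)"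
      using finJ \<alpha> by (simp add: prod.remove)
    also have "(\<Prod>\<gamma>\<in>J - {\<alpha>}. if \<gamma> = \<alpha> then - s \<gamma> else s \<gamma>) = prod s (J - {\<alpha>})"
      by (rule prod.cong) auto
    also have "- s \<alpha> * prod s (J - {\<alpha>}) = - prod s J" using finJ \<alpha> by (simp add: prod.remove)
    finally show ?thesis .
  qed
  ultimately have "prod s J = 0" by simp
  then have "C \<in> R j" using finJ J(1) s_eq_0_iff by (auto simp: prod_zero_iff)
  then show False using sep \<open>j < n\<close> by (auto simp: sep_def)
qed

section \<open>The critical orbit as a divisibility sequence\<close>

lemma a_Suc: "a (Suc k) = (a k)\<^sup>2 + c"
  by (simp add: a_def)

text \<open>Modulo \<open>d\<close> the orbit is back at its starting point 0 after \<open>k\<close>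
  steps, and \<open>x \<mapsto> x^2 + c\<close> respects congruences.\<close>

lemma a_cong:
  assumes "d dvd a k"
  shows "d dvd a (i + k) - a i"
proof (induction i)
  case 0
  then show ?case using assms by (simp add: a_def)
next
  case (Suc i)
  have "a (Suc i + k) - a (Suc i) = (a (i + k) - a i) * (a (i + k) + a i)"
    by (simp add: a_Suc algebra_simps power2_eq_square)
  then show ?case using Suc by simp
qed

lemma dvd_a_mod:
  assumes "d dvd a k"
  shows "d dvd a (i mod k) \<longleftrightarrow> d dvd a i"
proof -
  have "d dvd a (i + m * k) \<longleftrightarrow> d dvd a i" for m i
  proof (induction m)
    case (Suc m)
    have "d dvd a (i + m * k + k) \<longleftrightarrow> d dvd a (i + m * k)"
      using a_cong[OF assms, of "i + m * k"] by (metis dvd_diff_left_iff dvd_diff_right_iff)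
    then show ?case using Suc by (simp add: algebra_simps)
  qed simp
  from this[of "i mod k" "i div k"] show ?thesis by simp
qed

text \<open>Euclid's algorithm on the indices, each step being \<open>dvd_a_mod\<close>.\<close>

lemma dvd_a_gcd: "d dvd a i \<Longrightarrow> d dvd a k \<Longrightarrow> d dvd a (gcd i k)"
proof (induction i k rule: gcd_nat.induct)
  case (1 i k)
  show ?case
  proof (cases "k = 0")
    case True
    then show ?thesis using 1 by simp
  next
    case False
    then have "d dvd a (gcd k (i mod k))" using 1 dvd_a_mod[of d k i] by simp
    then show ?thesis by (metis gcd_red_nat)
  qed
qed

lemma f_poly_mult: "c * poly (f_poly n) c = a n"
proof -
  have "poly (poly (poly_iterate (quad [:0, 1:]) n) 0) c = a n"
    by (induction n) (simp_all add: poly_iterate_def quad_def poly_pcompose a_def power2_eq_square)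
  then show ?thesis using f_poly_exact[of n] by (metis poly_mult poly_pCons poly_0 mult_zero_right add_0 add.right_neutral mult.right_neutral)
qed

text \<open>Cancelling \<open>c\<close> in the recursion for \<open>a\<close> shows that the value
  of \<open>f_poly n\<close> at \<open>c\<close> is \<open>c\<close> times a square plus 1.\<close>

lemma coprime_f_poly_c:
  assumes "c \<noteq> 0" "n \<ge> 2"
  shows "coprime (poly (f_poly n) c) c"
proof -
  obtain m where m: "n = Suc (Suc m)" using assms(2) by (metis Suc_le_D numeral_2_eq_2 Suc_le_mono)
  have "a (Suc m) = c * poly (f_poly (Suc m)) c" by (simp add: f_poly_mult)
  then have "c * poly (f_poly n) c = c * (c * (poly (f_poly (Suc m)) c)\<^sup>2 + 1)"
    unfolding f_poly_mult m a_Suc[of "Suc m"] by (simp only: \<open>a (Suc m) = _\<close>)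
      (simp add: algebra_simps power2_eq_square)
  then have "poly (f_poly n) c = c * (poly (f_poly (Suc m)) c)\<^sup>2 + 1" using assms(1) by simp
  then show ?thesis
    by (intro coprimeI) (metis dvd_add_right_iff dvd_mult2)
qed

text \<open>A common divisor divides \<open>a p\<close> and \<open>a k\<close>, hence
  \<open>a (gcd k p) = a 1 = c\<close>, to which the value of \<open>f_poly p\<close> is
  coprime.\<close>

lemma coprime_f_poly_a:
  assumes "c \<noteq> 0" "Factorial_Ring.prime p" "k \<in> {1..<p}"
  shows "coprime (poly (f_poly p) c) (a k)"
proof (rule coprimeI)
  fix d assume d: "d dvd poly (f_poly p) c" "d dvd a k"
  then have "d dvd a p" using f_poly_mult[of p] by (metis dvd_mult)
  then have "d dvd a (gcd k p)" using d(2) dvd_a_gcd by blast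
  moreover have "gcd k p = 1"
    using assms(2,3) prime_imp_coprime[of p k] nat_dvd_not_less[of k p]
    by (simp add: coprime_iff_gcd_eq_1 gcd.commute)
  ultimately have "d dvd c" by (simp add: a_def)
  then show "is_unit d"
    using d(1) coprime_f_poly_c[OF assms(1), of p] prime_ge_2_nat[OF assms(2)]
      coprime_common_divisor by blast
qed

end

theorem theorem4p1:
  fixes c :: int and p :: nat
  assumes "Factorial_Ring.prime p" and "p \<ge> 3"
    and "\<not> (\<exists>y::int. y ^ 2 = poly (f_poly p) c)"
    and "\<not> (\<exists>y::int. - (y ^ 2) = poly (f_poly p) c)"
    and "full_arboreal_image (quad (of_int c)) (p - 1)"
  shows "full_arboreal_image (quad (of_int c)) p"
proof -
  interpret quadratic_tree c .
  let ?F = "poly (f_poly p) c"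
  obtain m where m: "p = Suc m" "m > 0" using assms(2) by (metis Suc_le_D Suc_le_mono numeral_3_eq_3 zero_less_Suc)
  have ind: "indep i" if "i < m" for i
    using indep_if_full_arboreal_image assms(5) that m by simp
  have "sep m"
    using assms(5) m by (simp add: full_arboreal_image_def complex_roots_iterate sep_if_card_R)
  \<comment> \<open>Level 0 consists of 0 alone, so separability there means
    \<open>c \<noteq> 0\<close>.\<close>
  then have "C \<notin> R 0" using m(2) by (simp add: sep_def)
  then have "c \<noteq> 0" by (simp add: R_0)
  \<comment> \<open>0 is a square, so the hypothesis rules it out. Then \<open>a p = c * ?F\<close>
    is nonzero, which extends separability from \<open>m\<close> to \<open>p\<close>.\<close>
  moreover have "?F \<noteq> 0" using assms(3) by (metis zero_power2)
  ultimately have "a p \<noteq> 0" using f_poly_mult[of p] by auto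
  then have sep: "sep p" using \<open>sep m\<close> C_in_R_iff[of m] m by (auto simp: sep_def less_Suc_eq)
  have "indep m"
  proof (rule indep_step[OF ind])
    show "sep (Suc m)" "m > 0" using sep m by simp_all
    show "coprime ?F (a k)" if "k \<in> {1..m}" for k
      using coprime_f_poly_a[OF \<open>c \<noteq> 0\<close> assms(1), of k] that m by auto
    show "a (Suc m) = ?F * c" using f_poly_mult[of p] m by (simp add: mult.commute)
    show "coprime ?F c" using coprime_f_poly_c[OF \<open>c \<noteq> 0\<close>, of p] assms(2) by simp
    show "\<nexists>y. y\<^sup>2 = ?F" "\<nexists>y. - (y\<^sup>2) = ?F" by fact+
  qed
  then have "indep i" if "i < p" for i using ind that m less_Suc_eq by auto
  then show ?thesis using full_arboreal_image_if_indep sep by blast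
qed

end
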